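(* Suppose $w\in A_2$. For a function $\varphi\in L^2(\mathbb{T})$, $$\|\varphi\|_{\mathcal{G},w}\approx\|\varphi\|_{\mathcal{G}},$$ i.e. each is bounded by a constant multiple of the other, where the constants depend only on $w$.
   Context: $\mathbb{T}$ is the unit circle, $\mathbb{D}$ the unit disc, $dm$ normalized arc length measure. A weight $w\ge0$ is in $A_2$ if $\sup_{I}\big(\frac{1}{|I|}\int_I w\,dm\big)\big(\frac{1}{|I|}\int_I w^{-1}dm\big)<\infty$ over subarcs $I\subset\mathbb{T}$. $P_z(\zeta)=\frac{1-|z|^2}{|1-\bar z\zeta|^2}$ is the Poisson kernel and $u(z)=\int_{\mathbb{T}}uP_z\,dm$ the Poisson extension of an integrable $u$. The Garsia norm is $\|\varphi\|_{\mathcal{G}}=\sup_{z\in\mathbb{D}}\big(\int_{\mathbb{T}}|\varphi-\varphi(z)|^2P_z\,dm\big)^{1/2}$ and the weighted Garsia norm is $\|\varphi\|_{\mathcal{G},w}=\sup_{z\in\mathbb{D}}\big(\frac{1}{w(z)}\int_{\mathbb{T}}|\varphi-\varphi(z)|^2P_z\,w\,dm\big)^{1/2}$. *)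

theory Defs
  imports "HOL-Analysis.Analysis"
begin

text \<open>The unit circle is parametrised by t in [0, 2pi] via cis t; the normalised
  arc-length measure dm corresponds to dt/(2 pi).  Functions on the circle are
  functions on complex numbers, only their values on the circle matter.\<close>

definition ennsqrt :: "ennreal \<Rightarrow> ennreal" where
  "ennsqrt x = (if x = \<infinity> then \<infinity> else ennreal (sqrt (enn2real x)))"

definition poisson_kernel :: "complex \<Rightarrow> complex \<Rightarrow> real" where
  "poisson_kernel z \<zeta> = (1 - (cmod z)^2) / (cmod (1 - cnj z * \<zeta>))^2"

definition poisson_ext :: "(complex \<Rightarrow> 'a::{real_normed_field,banach,second_countable_topology}) \<Rightarrow> complex \<Rightarrow> 'a" where
  "poisson_ext u z =
     (LINT t:{0..2*pi}|lborel. of_real (poisson_kernel z (cis t)) * u (cis t)) / of_real (2*pi)"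

definition L2_circle :: "(complex \<Rightarrow> complex) \<Rightarrow> bool" where
  "L2_circle \<phi> \<longleftrightarrow> set_borel_measurable lborel {0..2*pi} (\<lambda>t. \<phi> (cis t)) \<and>
     set_integrable lborel {0..2*pi} (\<lambda>t. (cmod (\<phi> (cis t)))^2)"

text \<open>Muckenhoupt A_2 weights.  A subarc I of the circle is {cis t | t in [a, a+l]}
  with 0 < l <= 2 pi; then |I| = l/(2 pi) and (1/|I|) int_I w dm = (1/l) int_a^(a+l) w(cis t) dt.
  Integrals of w^{-1} are taken in [0,infinity] (with 1/0 = infinity); both averages
  are required finite and their product uniformly bounded.\<close>
definition A2_weight :: "(complex \<Rightarrow> real) \<Rightarrow> bool" where
  "A2_weight w \<longleftrightarrow>
     (\<forall>t. w (cis t) \<ge> 0) \<and> (\<lambda>t. w (cis t)) \<in> borel_measurable lborel \<and>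
     (\<exists>C::real. \<forall>a l. 0 < l \<and> l \<le> 2*pi \<longrightarrow>
        (\<integral>\<^sup>+ t\<in>{a..a+l}. ennreal (w (cis t)) \<partial>lborel) < \<infinity> \<and>
        (\<integral>\<^sup>+ t\<in>{a..a+l}. inverse (ennreal (w (cis t))) \<partial>lborel) < \<infinity> \<and>
        ennreal (1/l) * (\<integral>\<^sup>+ t\<in>{a..a+l}. ennreal (w (cis t)) \<partial>lborel) *
        (ennreal (1/l) * (\<integral>\<^sup>+ t\<in>{a..a+l}. inverse (ennreal (w (cis t))) \<partial>lborel))
          \<le> ennreal C)"

definition garsia_norm :: "(complex \<Rightarrow> complex) \<Rightarrow> ennreal" where
  "garsia_norm \<phi> = (SUP z\<in>ball 0 1. ennsqrt
     ((\<integral>\<^sup>+ t\<in>{0..2*pi}. ennreal ((cmod (\<phi> (cis t) - poisson_ext \<phi> z))^2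
          * poisson_kernel z (cis t)) \<partial>lborel) / ennreal (2*pi)))"

definition garsia_norm_w :: "(complex \<Rightarrow> real) \<Rightarrow> (complex \<Rightarrow> complex) \<Rightarrow> ennreal" where
  "garsia_norm_w w \<phi> = (SUP z\<in>ball 0 1. ennsqrt
     (ennreal (1 / poisson_ext w z) *
      ((\<integral>\<^sup>+ t\<in>{0..2*pi}. ennreal ((cmod (\<phi> (cis t) - poisson_ext \<phi> z))^2
          * poisson_kernel z (cis t) * w (cis t)) \<partial>lborel) / ennreal (2*pi))))"

end

theory Submission
  imports Defs
begin

text \<open>Both Garsia norms are comparable with the \<open>L\<^sup>1\<close> mean oscillation of \<open>\<phi>\<close> over arcs.

  The oscillation is bounded by the weighted norm: on the arc belonging to \<open>z\<close> the Poisson kernel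
  is bounded below by the inverse of the length, so Cauchy--Schwarz against the dual weight
  \<open>1 / w\<close> and the \<open>A\<^sub>2\<close> condition apply.

  The weighted norm is bounded by the oscillation through a weighted John--Nirenberg inequality in
  \<open>L\<^sup>2\<close>, which needs no reverse Hoelder inequality: the stopping intervals of a
  Calderon--Zygmund decomposition at height twice the oscillation cover at most half of the
  interval, so by \<open>A\<^sub>2\<close> they carry at most a fixed fraction less than one of its
  \<open>w\<close>-mass, and the estimate closes by induction on the dyadic depth. The passage from arcs to
  Poisson averages is a sum over dyadic dilates of an arc, controlled by the reverse doubling of
  \<open>1 / w\<close>. The unweighted norm is the case \<open>w = 1\<close>.\<close>

section \<open>Dyadic averages\<close>

text \<open>The weighted L2 integral of \<open>f\<close> is not known to be finite beforehand, so
  nothing can be absorbed into it. The estimate is therefore proved for averages of a fixed dyadic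
  depth, which involve finite sums only, with a constant independent of the depth; Fatou's lemma
  then passes to \<open>f\<close>.

  The centre of the weighted norm at \<open>z\<close> is a Poisson average with respect to arc
  length, not with respect to \<open>w\<close>. Its distance to the mean over the arc belonging to
  \<open>z\<close> is controlled by the same estimate for the constant weight, so two instances of
  the constant enter the upper bound. In the lower bound any centre will do, since replacing it by
  the mean costs a factor 2.

  Mean oscillation does not mention a weight. One comparison between two arbitrary weights therefore
  yields both inequalities, one of the weights being 1 each time.

  Half-open intervals on the line make bisection an exact partition, and arcs through the angle 0
  become ordinary intervals.\<close>

definition loc_integrable :: "(real \<Rightarrow> 'a::{banach,second_countable_topology}) \<Rightarrow> bool" where
  "loc_integrable f \<longleftrightarrow> (\<forall>a b. set_integrable lborel {a..<b} f)"

lemma loc_integrableD: "loc_integrable f \<Longrightarrow> set_integrable lborel {a..<b} f"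
  by (simp add: loc_integrable_def)

lemma loc_integrable_subset:
  assumes "loc_integrable f" "E \<in> sets borel" "E \<subseteq> {a..<b}"
  shows "set_integrable lborel E f"
  using set_integrable_subset[OF loc_integrableD[OF assms(1)], of E a b] assms by simp

lemma set_integrable_const_subset:
  fixes c :: "'a::{banach,second_countable_topology}"
  assumes "E \<in> sets borel" "E \<subseteq> {a..<b::real}"
  shows "set_integrable lborel E (\<lambda>_. c)"
proof -
  have "set_integrable lborel {a..<b} (\<lambda>_. c)"
    unfolding set_integrable_def by (cases "a \<le> b") auto
  then show ?thesis
    by (rule set_integrable_subset) (use assms in auto)
qed

lemma loc_integrable_const [simp]: "loc_integrable (\<lambda>_. c)"
  by (auto simp: loc_integrable_def intro: set_integrable_const_subset)

lemma loc_integrable_diff: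
  "loc_integrable f \<Longrightarrow> loc_integrable g \<Longrightarrow> loc_integrable (\<lambda>t. f t - g t)"
  by (simp add: loc_integrable_def)

lemma loc_integrable_norm: "loc_integrable f \<Longrightarrow> loc_integrable (\<lambda>t. norm (f t))"
  unfolding loc_integrable_def by (auto intro: set_integrable_norm)

lemma loc_integrable_continuous:
  fixes g :: "real \<Rightarrow> complex"
  assumes "continuous_on UNIV g"
  shows "loc_integrable g"
  unfolding loc_integrable_def
proof (intro allI)
  fix a b
  have "set_integrable lborel {a..b} g"
    by (rule borel_integrable_atLeastAtMost') (use assms continuous_on_subset in blast)
  then show "set_integrable lborel {a..<b} g"
    by (rule set_integrable_subset) auto
qed

lemma set_integral_split:
  assumes "loc_integrable f" "a \<le> m" "m \<le> b"
  shows "(LINT t:{a..<b}|lborel. f t) = (LINT t:{a..<m}|lborel. f t) + (LINT t:{m..<b}|lborel. f t)"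
proof -
  have "{a..<b} = {a..<m} \<union> {m..<b}" using assms by auto
  then show ?thesis
    using set_integral_Un[of "{a..<m}" "{m..<b}" lborel f] loc_integrableD[OF assms(1)]
    by auto
qed

lemma nn_integral_split:
  assumes "f \<in> borel_measurable borel" "a \<le> m" "m \<le> (b::real)"
  shows "(\<integral>\<^sup>+ t\<in>{a..<b}. f t \<partial>lborel)
    = (\<integral>\<^sup>+ t\<in>{a..<m}. f t \<partial>lborel) + (\<integral>\<^sup>+ t\<in>{m..<b}. f t \<partial>lborel)"
proof -
  have "{a..<b} = {a..<m} \<union> {m..<b}" using assms by auto
  then show ?thesis
    using nn_integral_disjoint_pair[of f lborel "{a..<m}" "{m..<b}"] assms by auto
qed

lemma nn_integral_eq_set_integral:
  fixes g :: "'a \<Rightarrow> real"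
  assumes "set_integrable M A g" "\<And>x. x \<in> A \<Longrightarrow> 0 \<le> g x"
  shows "(\<integral>\<^sup>+x\<in>A. ennreal (g x) \<partial>M) = ennreal (LINT x:A|M. g x)"
proof -
  have "(\<integral>\<^sup>+x\<in>A. ennreal (g x) \<partial>M) = (\<integral>\<^sup>+x. ennreal (indicator A x *\<^sub>R g x) \<partial>M)"
    by (intro nn_integral_cong) (simp split: split_indicator)
  also have "\<dots> = ennreal (LINT x:A|M. g x)"
    unfolding set_lebesgue_integral_def
    by (rule nn_integral_eq_integral)
      (use assms in \<open>auto simp: set_integrable_def split: split_indicator\<close>)
  finally show ?thesis .
qed

lemma set_integral_nonneg_real:
  fixes g :: "'a \<Rightarrow> real"
  assumes "\<And>x. x \<in> A \<Longrightarrow> 0 \<le> g x"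
  shows "0 \<le> (LINT x:A|M. g x)"
  unfolding set_lebesgue_integral_def
  by (rule integral_nonneg_AE) (use assms in \<open>auto split: split_indicator\<close>)

definition avg :: "(real \<Rightarrow> complex) \<Rightarrow> real \<Rightarrow> real \<Rightarrow> complex" where
  "avg f a b = (LINT t:{a..<b}|lborel. f t) / of_real (b - a)"

lemma avg_diff:
  "loc_integrable f \<Longrightarrow> loc_integrable g \<Longrightarrow> avg (\<lambda>t. f t - g t) a b = avg f a b - avg g a b"
  by (simp add: avg_def loc_integrableD diff_divide_distrib)

lemma avg_const: "a < b \<Longrightarrow> avg (\<lambda>_. c) a b = c"
  by (simp add: avg_def set_integral_const scaleR_conv_of_real)

lemma norm_avg_le:
  assumes "a < b"
  shows "norm (avg f a b) * (b - a) \<le> (LINT t:{a..<b}|lborel. norm (f t))"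
proof -
  have "norm (avg f a b) * (b - a) = norm (LINT t:{a..<b}|lborel. f t)"
    using assms by (simp add: avg_def norm_divide del: of_real_diff)
  also have "\<dots> \<le> (LINT t:{a..<b}|lborel. norm (f t))"
    unfolding set_lebesgue_integral_def
    by (rule order_trans[OF integral_norm_bound]) simp
  finally show ?thesis .
qed

lemma norm_avg_minus_le:
  assumes "a < b" "loc_integrable f"
  shows "norm (avg f a b - c) * (b - a) \<le> (LINT t:{a..<b}|lborel. norm (f t - c))"
  using norm_avg_le[OF assms(1), of "\<lambda>t. f t - c"] assms by (simp add: avg_diff avg_const)

text \<open>The conditional expectation of \<open>f\<close> on the dyadic pieces of generation
  \<open>n\<close> of the interval, evaluated at \<open>t\<close>. A point outside the interval
  receives the mean over an outermost piece; the integrals below are all restricted to the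
  interval.\<close>

fun dyadic_avg :: "(real \<Rightarrow> complex) \<Rightarrow> nat \<Rightarrow> real \<Rightarrow> real \<Rightarrow> real \<Rightarrow> complex" where
  "dyadic_avg f 0 a b t = avg f a b"
| "dyadic_avg f (Suc n) a b t =
     (if t < (a + b) / 2 then dyadic_avg f n a ((a + b) / 2) t else dyadic_avg f n ((a + b) / 2) b t)"

lemma dyadic_avg_measurable [measurable]: "dyadic_avg f n a b \<in> borel_measurable borel"
proof (induction n arbitrary: a b)
  case 0
  then show ?case by simp
next
  case (Suc n)
  note Suc [measurable]
  have "dyadic_avg f (Suc n) a b = (\<lambda>t. if t < (a + b) / 2 then dyadic_avg f n a ((a + b) / 2) t
      else dyadic_avg f n ((a + b) / 2) b t)"
    by auto
  then show ?case by simp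
qed

lemma dyadic_avg_diff:
  "loc_integrable f \<Longrightarrow> loc_integrable g \<Longrightarrow>
    dyadic_avg (\<lambda>t. f t - g t) n a b t = dyadic_avg f n a b t - dyadic_avg g n a b t"
  by (induction n arbitrary: a b) (simp_all add: avg_diff)

text \<open>One bisection step for integrals of a function of the dyadic average. With the norm for
  \<open>G\<close> and \<open>h = 1\<close> it serves the L1 contraction; with a squared distance
  for \<open>G\<close> and the weight for \<open>h\<close> it identifies \<open>leaf_sum\<close> as
  an integral.\<close>

lemma nn_integral_dyadic_split:
  assumes "G \<in> borel_measurable borel" "a < b" and [simp]: "m = (a + b) / 2"
    and [measurable]: "h \<in> borel_measurable borel"
  shows "(\<integral>\<^sup>+ t\<in>{a..<b}. G (dyadic_avg f (Suc n) a b t) * h t \<partial>lborel)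
    = (\<integral>\<^sup>+ t\<in>{a..<m}. G (dyadic_avg f n a m t) * h t \<partial>lborel)
      + (\<integral>\<^sup>+ t\<in>{m..<b}. G (dyadic_avg f n m b t) * h t \<partial>lborel)" (is "?l = ?r1 + ?r2")
proof -
  note assms(1) [measurable]
  have "?l = (\<integral>\<^sup>+ t\<in>{a..<m}. G (dyadic_avg f (Suc n) a b t) * h t \<partial>lborel)
      + (\<integral>\<^sup>+ t\<in>{m..<b}. G (dyadic_avg f (Suc n) a b t) * h t \<partial>lborel)"
    by (rule nn_integral_split) (use assms(2) in auto)
  also have "(\<integral>\<^sup>+ t\<in>{a..<m}. G (dyadic_avg f (Suc n) a b t) * h t \<partial>lborel) = ?r1"
    by (intro set_nn_integral_cong) auto
  also have "(\<integral>\<^sup>+ t\<in>{m..<b}. G (dyadic_avg f (Suc n) a b t) * h t \<partial>lborel) = ?r2"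
    by (intro set_nn_integral_cong) auto
  finally show ?thesis .
qed

text \<open>Conditional expectation contracts L1: depth 0 is the triangle inequality for integrals,
  and bisection adds up. The bound is uniform in \<open>n\<close>, which lets an L1 approximation of
  \<open>f\<close> pass to all its averages.\<close>

lemma nn_integral_dyadic_avg_le:
  assumes "loc_integrable f" "f \<in> borel_measurable borel" "a < b"
  shows "(\<integral>\<^sup>+ t\<in>{a..<b}. ennreal (norm (dyadic_avg f n a b t)) \<partial>lborel)
    \<le> (\<integral>\<^sup>+ t\<in>{a..<b}. ennreal (norm (f t)) \<partial>lborel)"
  using assms(3)
proof (induction n arbitrary: a b)
  case 0
  have "(\<integral>\<^sup>+ t\<in>{a..<b}. ennreal (norm (dyadic_avg f 0 a b t)) \<partial>lborel) = ennreal (norm (avg f a b) * (b - a))"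
    using 0 by (simp add: nn_integral_cmult_indicator ennreal_mult)
  also have "\<dots> \<le> ennreal (LINT t:{a..<b}|lborel. norm (f t))"
    using norm_avg_le[OF 0] by (rule ennreal_leI)
  also have "\<dots> = (\<integral>\<^sup>+ t\<in>{a..<b}. ennreal (norm (f t)) \<partial>lborel)"
    by (subst nn_integral_eq_set_integral)
      (use loc_integrable_norm[OF assms(1)] in \<open>auto simp: loc_integrableD\<close>)
  finally show ?case .
next
  case (Suc n)
  note assms(2) [measurable]
  show ?case
    using nn_integral_dyadic_split[of "\<lambda>x. ennreal (norm x)" a b "(a + b) / 2" "\<lambda>_. 1" f n] Suc.prems
      add_mono[OF Suc.IH[of a "(a + b) / 2"] Suc.IH[of "(a + b) / 2" b]]
      nn_integral_split[of "\<lambda>t. ennreal (norm (f t))" a "(a + b) / 2" b]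
    by simp
qed

lemma norm_avg_minus_le_bound:
  assumes "a < b" "loc_integrable f" "\<And>t. t \<in> {a..<b} \<Longrightarrow> norm (f t - c) \<le> e"
  shows "norm (avg f a b - c) \<le> e"
proof -
  have "(LINT t:{a..<b}|lborel. norm (f t - c)) \<le> (LINT t:{a..<b}|lborel. e)"
    by (rule set_integral_mono)
      (use assms in \<open>auto intro!: loc_integrableD loc_integrable_norm loc_integrable_diff\<close>)
  also have "\<dots> = e * (b - a)"
    using assms by (simp add: set_integral_const)
  finally show ?thesis
    using norm_avg_minus_le[OF assms(1,2), of c] assms(1) by (smt (verit) mult_right_le_imp_le)
qed

text \<open>The average is taken over a piece of length \<open>(b - a) / 2 ^ n\<close> containing
  \<open>t\<close>, so only the modulus of continuity at that scale enters. Bisecting the interval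
  while lowering \<open>n\<close> by one leaves this length unchanged, so the hypothesis is
  inherited by both halves.\<close>

lemma dyadic_avg_near:
  assumes "loc_integrable f" "t \<in> {a..<b}"
    "\<And>s t. s \<in> {a..b} \<Longrightarrow> t \<in> {a..b} \<Longrightarrow> \<bar>s - t\<bar> \<le> (b - a) / 2 ^ n \<Longrightarrow> norm (f s - f t) \<le> e"
  shows "norm (dyadic_avg f n a b t - f t) \<le> e"
  using assms(2,3)
proof (induction n arbitrary: a b)
  case 0
  then show ?case
    using assms(1) by (auto intro!: norm_avg_minus_le_bound)
next
  case (Suc n)
  define m where "m = (a + b) / 2"
  have m: "a < m" "m < b" "(m - a) / 2 ^ n = (b - a) / 2 ^ Suc n" "(b - m) / 2 ^ n = (b - a) / 2 ^ Suc n"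
    using Suc.prems(1) by (auto simp: m_def field_simps)
  show ?case
  proof (cases "t < m")
    case True
    then have "norm (dyadic_avg f n a m t - f t) \<le> e"
      using Suc.prems m by (intro Suc.IH) auto
    then show ?thesis using True by (simp add: m_def)
  next
    case False
    then have "norm (dyadic_avg f n m b t - f t) \<le> e"
      using Suc.prems m by (intro Suc.IH) auto
    then show ?thesis using False by (simp add: m_def)
  qed
qed

section \<open>Density of continuous functions in L1\<close>

lemma indicator_approx_continuous:
  fixes c :: complex and e :: real
  assumes "A \<in> sets borel" "e > 0"
  obtains g :: "real \<Rightarrow> complex" where "continuous_on UNIV g"
    "(\<integral>\<^sup>+ t. ennreal (norm (indicator A t *\<^sub>R c - g t)) \<partial>lborel) < ennreal e"
proof -
  \<comment> \<open>The error will live on \<open>U - K\<close>, of measure at most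
    \<open>2 * d\<close>, and be bounded there by \<open>norm c\<close>; the summand 1 covers
    \<open>c = 0\<close>.\<close>
  define d where "d = e / (2 * (norm c + 1))"
  have d: "d > 0" using assms by (auto simp: d_def add_nonneg_pos)
  have A: "A \<in> sets lebesgue" using assms by simp
  obtain U where U: "open U" "A \<subseteq> U" "emeasure lebesgue (U - A) < ennreal d"
    using sets_lebesgue_outer_open[OF A d] by metis
  obtain K where K: "closed K" "K \<subseteq> A" "emeasure lebesgue (A - K) < ennreal d"
    using sets_lebesgue_inner_closed[OF A d] by metis
  have [measurable]: "U \<in> sets borel" "K \<in> sets borel" "A \<in> sets borel"
    using U K assms by auto
  \<comment> \<open>Values on the segment from \<open>c\<close> to 0 keep both
    \<open>norm (g t)\<close> and \<open>norm (c - g t)\<close> at most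
    \<open>norm c\<close>.\<close>
  obtain g :: "real \<Rightarrow> complex" where g: "continuous_on UNIV g" "\<And>x. g x \<in> closed_segment c 0"
      "\<And>x. x \<in> K \<Longrightarrow> g x = c" "\<And>x. x \<in> - U \<Longrightarrow> g x = 0"
    using Urysohn[of K "-U" c 0] U K by (metis closed_Compl disjoint_eq_subset_Compl double_compl subset_trans)
  have le: "norm (indicator A t *\<^sub>R c - g t) \<le> norm c * indicator (U - K) t" for t
  proof -
    obtain u where u: "0 \<le> u" "u \<le> 1" "g t = (1 - u) *\<^sub>R c"
      using g(2)[of t] by (auto simp: closed_segment_def)
    have "c - (1 - u) *\<^sub>R c = u *\<^sub>R c"
      by (simp add: scaleR_left_diff_distrib)
    then have "norm (g t) \<le> norm c" "norm (c - g t) \<le> norm c"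
      using u by (auto simp: mult_left_le_one_le)
    then show ?thesis
      using g(3,4)[of t] U K by (auto split: split_indicator)
  qed
  have "(\<integral>\<^sup>+ t. ennreal (norm (indicator A t *\<^sub>R c - g t)) \<partial>lborel)
      \<le> (\<integral>\<^sup>+ t. ennreal (norm c) * indicator (U - K) t \<partial>lborel)"
  proof (rule nn_integral_mono)
    fix t
    show "ennreal (norm (indicator A t *\<^sub>R c - g t)) \<le> ennreal (norm c) * indicator (U - K) t"
      using ennreal_leI[OF le[of t]] by (auto split: split_indicator)
  qed
  also have "\<dots> = ennreal (norm c) * emeasure lborel (U - K)"
    by (simp add: nn_integral_cmult_indicator)
  also have "U - K = (U - A) \<union> (A - K)" using U K by auto
  also have "emeasure lborel \<dots> \<le> emeasure lborel (U - A) + emeasure lborel (A - K)"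
    by (rule emeasure_subadditive) auto
  also have "\<dots> \<le> ennreal d + ennreal d"
    using U(3) K(3) by (intro add_mono) (auto simp: less_imp_le)
  also have "ennreal (norm c) * (ennreal d + ennreal d) = ennreal (norm c * (2 * d))"
    using d by (simp add: ennreal_mult' flip: ennreal_plus)
  also have "norm c * (2 * d) < e"
  proof -
    have "norm c * (2 * d) < (norm c + 1) * (2 * d)"
      using d by (intro mult_strict_right_mono) auto
    also have "\<dots> = e"
      unfolding d_def using norm_ge_zero[of c] by (simp add: field_simps del: norm_ge_zero)
    finally show ?thesis .
  qed
  then have "ennreal (norm c * (2 * d)) < ennreal e"
    using assms by (simp add: ennreal_lessI)
  finally show ?thesis
    using that g(1) by (simp add: mult_left_mono)
qed

lemma nn_integral_norm_triangle:
  fixes f g h :: "'a \<Rightarrow> 'b::{banach,second_countable_topology}"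
  assumes [measurable]: "f \<in> borel_measurable M" "g \<in> borel_measurable M" "h \<in> borel_measurable M"
  shows "(\<integral>\<^sup>+ t. ennreal (norm (f t - h t)) \<partial>M)
    \<le> (\<integral>\<^sup>+ t. ennreal (norm (f t - g t)) \<partial>M) + (\<integral>\<^sup>+ t. ennreal (norm (g t - h t)) \<partial>M)"
proof -
  have "(\<integral>\<^sup>+ t. ennreal (norm (f t - h t)) \<partial>M)
      \<le> (\<integral>\<^sup>+ t. ennreal (norm (f t - g t)) + ennreal (norm (g t - h t)) \<partial>M)"
    by (intro nn_integral_mono)
      (auto simp flip: ennreal_plus intro!: ennreal_leI norm_triangle_sub norm_diff_triangle_le)
  also have "\<dots> = (\<integral>\<^sup>+ t. ennreal (norm (f t - g t)) \<partial>M) + (\<integral>\<^sup>+ t. ennreal (norm (g t - h t)) \<partial>M)"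
    by (rule nn_integral_add) auto
  finally show ?thesis .
qed

lemma integrable_approx_continuous:
  fixes f :: "real \<Rightarrow> complex"
  assumes "integrable lborel f" "e > 0"
  shows "\<exists>g :: real \<Rightarrow> complex. continuous_on UNIV g \<and> (\<integral>\<^sup>+ t. ennreal (norm (f t - g t)) \<partial>lborel) < ennreal e"
  using assms
proof (induction arbitrary: e rule: integrable_induct)
  case (base A c)
  then show ?case
    using indicator_approx_continuous[of A e c] by (metis sets_lborel)
next
  case (add f h)
  obtain g1 g2 where g: "continuous_on UNIV g1" "(\<integral>\<^sup>+ t. ennreal (norm (f t - g1 t)) \<partial>lborel) < ennreal (e / 2)"
      "continuous_on UNIV g2" "(\<integral>\<^sup>+ t. ennreal (norm (h t - g2 t)) \<partial>lborel) < ennreal (e / 2)"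
    using add.IH[of "e / 2"] add.prems by (metis half_gt_zero)
  note [measurable] = borel_measurable_continuous_onI[OF g(1)] borel_measurable_continuous_onI[OF g(3)]
  have [measurable]: "f \<in> borel_measurable borel" "h \<in> borel_measurable borel"
    using add.hyps by auto
  have "(\<integral>\<^sup>+ t. ennreal (norm (f t + h t - (g1 t + g2 t))) \<partial>lborel)
      \<le> (\<integral>\<^sup>+ t. ennreal (norm (f t - g1 t)) + ennreal (norm (h t - g2 t)) \<partial>lborel)"
    by (intro nn_integral_mono)
      (auto simp flip: ennreal_plus intro!: ennreal_leI norm_diff_triangle_ineq)
  also have "\<dots> = (\<integral>\<^sup>+ t. ennreal (norm (f t - g1 t)) \<partial>lborel) + (\<integral>\<^sup>+ t. ennreal (norm (h t - g2 t)) \<partial>lborel)"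
    by (rule nn_integral_add) auto
  also have "\<dots> < ennreal (e / 2) + ennreal (e / 2)"
    using g(2,4) by (rule add_strict_mono)
  also have "\<dots> = ennreal e"
    using add.prems by (simp flip: ennreal_plus)
  finally show ?case
    using g continuous_on_add[OF g(1,3)] by blast
next
  case (lim f s)
  have [measurable]: "f \<in> borel_measurable borel" "\<And>i. s i \<in> borel_measurable borel"
    using lim.hyps by auto
  have "(\<lambda>i. \<integral>\<^sup>+ t. norm (f t - s i t) \<partial>lborel) \<longlonglongrightarrow> 0"
  \<comment> \<open>The induction principle supplies approximants bounded by twice the norm of
    \<open>f\<close>, hence this majorant.\<close>
  proof (rule nn_integral_dominated_convergence_norm[where w="\<lambda>t. 2 * norm (f t)"])
    show "(\<integral>\<^sup>+ t. ennreal (2 * norm (f t)) \<partial>lborel) < \<infinity>"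
      using lim.hyps(4) by (simp add: integrable_iff_bounded nn_integral_cmult ennreal_mult ennreal_mult_less_top)
  qed (use lim.hyps in auto)
  then have "eventually (\<lambda>i. (\<integral>\<^sup>+ t. norm (f t - s i t) \<partial>lborel) < ennreal (e / 2)) sequentially"
    by (rule order_tendstoD) (use lim.prems in simp)
  then obtain i where i: "(\<integral>\<^sup>+ t. norm (f t - s i t) \<partial>lborel) < ennreal (e / 2)"
    by (auto simp: eventually_sequentially)
  obtain g where g: "continuous_on UNIV g" "(\<integral>\<^sup>+ t. ennreal (norm (s i t - g t)) \<partial>lborel) < ennreal (e / 2)"
    using lim.IH[of "e / 2" i] lim.prems by auto
  note [measurable] = borel_measurable_continuous_onI[OF g(1)]
  have "(\<integral>\<^sup>+ t. ennreal (norm (f t - g t)) \<partial>lborel)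
      \<le> (\<integral>\<^sup>+ t. ennreal (norm (f t - s i t)) \<partial>lborel) + (\<integral>\<^sup>+ t. ennreal (norm (s i t - g t)) \<partial>lborel)"
    by (rule nn_integral_norm_triangle) auto
  also have "\<dots> < ennreal (e / 2) + ennreal (e / 2)"
    using i g(2) by (rule add_strict_mono)
  also have "\<dots> = ennreal e"
    using lim.prems by (simp flip: ennreal_plus)
  finally show ?case
    using g by blast
qed

text \<open>For a continuous \<open>g\<close> close to \<open>f\<close>, the averages of
  \<open>f - g\<close> are small by the L1 contraction, those of \<open>g\<close> are close to
  \<open>g\<close> by uniform continuity, and \<open>g - f\<close> is small by choice. Three
  quarters of \<open>e\<close> leave room for the strict inequality.\<close>

lemma dyadic_avg_tendsto_L1:
  assumes "loc_integrable f" "f \<in> borel_measurable borel" "a < b"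
  shows "(\<lambda>n. \<integral>\<^sup>+ t\<in>{a..<b}. ennreal (norm (dyadic_avg f n a b t - f t)) \<partial>lborel) \<longlonglongrightarrow> 0"
proof (rule tendsto_zero_ennreal)
  fix e :: real assume e: "0 < e"
  note assms(2) [measurable]
  define I where "I = (\<lambda>h :: real \<Rightarrow> complex. \<integral>\<^sup>+ t\<in>{a..<b}. ennreal (norm (h t)) \<partial>lborel)"
  have tri: "I (\<lambda>t. h1 t - h3 t) \<le> I (\<lambda>t. h1 t - h2 t) + I (\<lambda>t. h2 t - h3 t)"
    if [measurable]: "h1 \<in> borel_measurable borel" "h2 \<in> borel_measurable borel" "h3 \<in> borel_measurable borel"
    for h1 h2 h3
  proof -
    have "I (\<lambda>t. h1 t - h3 t)
        \<le> (\<integral>\<^sup>+ t\<in>{a..<b}. (ennreal (norm (h1 t - h2 t)) + ennreal (norm (h2 t - h3 t))) \<partial>lborel)"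
      unfolding I_def
      by (intro nn_integral_mono mult_right_mono)
        (auto simp flip: ennreal_plus intro!: ennreal_leI norm_diff_triangle_le)
    also have "\<dots> = I (\<lambda>t. h1 t - h2 t) + I (\<lambda>t. h2 t - h3 t)"
      unfolding I_def by (rule nn_set_integral_add) auto
    finally show ?thesis .
  qed
  have "integrable lborel (\<lambda>t. indicator {a..<b} t *\<^sub>R f t)"
    using loc_integrableD[OF assms(1)] by (simp add: set_integrable_def)
  then obtain g where g: "continuous_on UNIV g"
      "(\<integral>\<^sup>+ t. ennreal (norm (indicator {a..<b} t *\<^sub>R f t - g t)) \<partial>lborel) < ennreal (e / 4)"
    using integrable_approx_continuous[of _ "e / 4"] e by (metis zero_less_divide_iff zero_less_numeral)
  note [measurable] = borel_measurable_continuous_onI[OF g(1)]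
  have "I (\<lambda>t. f t - g t) \<le> (\<integral>\<^sup>+ t. ennreal (norm (indicator {a..<b} t *\<^sub>R f t - g t)) \<partial>lborel)"
    unfolding I_def by (intro nn_integral_mono) (auto split: split_indicator)
  also note g(2)
  finally have fg: "I (\<lambda>t. f t - g t) < ennreal (e / 4)" .
  have gf: "I (\<lambda>t. g t - f t) < ennreal (e / 4)"
    using fg by (simp add: I_def norm_minus_commute)
  have lg: "loc_integrable g" using g(1) by (rule loc_integrable_continuous)
  have Dfg: "I (\<lambda>t. dyadic_avg f n a b t - dyadic_avg g n a b t) < ennreal (e / 4)" for n
  proof -
    have "I (dyadic_avg (\<lambda>t. f t - g t) n a b) \<le> I (\<lambda>t. f t - g t)"
      unfolding I_def by (rule nn_integral_dyadic_avg_le) (use assms lg in \<open>auto intro: loc_integrable_diff\<close>)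
    moreover have "dyadic_avg (\<lambda>t. f t - g t) n a b = (\<lambda>t. dyadic_avg f n a b t - dyadic_avg g n a b t)"
      using assms lg by (simp add: fun_eq_iff dyadic_avg_diff)
    ultimately show ?thesis
      using fg by simp
  qed
  have "uniformly_continuous_on {a..b} g"
    by (rule compact_uniformly_continuous) (use g(1) continuous_on_subset in auto)
  then obtain d where d: "d > 0"
      "\<And>s t. s \<in> {a..b} \<Longrightarrow> t \<in> {a..b} \<Longrightarrow> dist s t < d \<Longrightarrow> dist (g s) (g t) < e / (4 * (b - a))"
    unfolding uniformly_continuous_on_def using e assms(3)
    by (metis diff_gt_0_iff_gt divide_pos_pos mult_pos_pos zero_less_numeral)
  have "(\<lambda>n. (b - a) * (1 / 2) ^ n) \<longlonglongrightarrow> (b - a) * 0"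
    by (intro tendsto_intros LIMSEQ_power_zero) auto
  then have "eventually (\<lambda>n. (b - a) * (1 / 2) ^ n < d) sequentially"
    by (rule order_tendstoD) (use d in simp)
  then show "\<forall>\<^sub>F n in sequentially.
      (\<integral>\<^sup>+ t\<in>{a..<b}. ennreal (norm (dyadic_avg f n a b t - f t)) \<partial>lborel) < ennreal e"
  proof eventually_elim
    case (elim n)
    then have n: "(b - a) / 2 ^ n < d" by (simp add: power_divide)
    have near: "norm (dyadic_avg g n a b t - g t) \<le> e / (4 * (b - a))" if "t \<in> {a..<b}" for t
    proof (rule dyadic_avg_near[OF lg that])
      fix s t assume "s \<in> {a..b}" "t \<in> {a..b}" "\<bar>s - t\<bar> \<le> (b - a) / 2 ^ n"
      then show "norm (g s - g t) \<le> e / (4 * (b - a))"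
        using d(2)[of s t] n by (simp add: dist_norm less_imp_le)
    qed
    have "I (\<lambda>t. dyadic_avg g n a b t - g t) \<le> (\<integral>\<^sup>+ t. ennreal (e / (4 * (b - a))) * indicator {a..<b} t \<partial>lborel)"
      unfolding I_def by (intro nn_integral_mono) (use near in \<open>auto intro!: ennreal_leI split: split_indicator\<close>)
    also have "\<dots> = ennreal (e / (4 * (b - a)) * (b - a))"
      using assms(3) e by (subst ennreal_mult) (auto simp: nn_integral_cmult_indicator)
    also have "e / (4 * (b - a)) * (b - a) = e / 4"
      using assms(3) by (simp add: field_simps)
    finally have Dg: "I (\<lambda>t. dyadic_avg g n a b t - g t) \<le> ennreal (e / 4)" .
    have "I (\<lambda>t. dyadic_avg f n a b t - f t)
        \<le> I (\<lambda>t. dyadic_avg f n a b t - dyadic_avg g n a b t) + I (\<lambda>t. dyadic_avg g n a b t - f t)"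
      by (rule tri) auto
    also have "\<dots> \<le> I (\<lambda>t. dyadic_avg f n a b t - dyadic_avg g n a b t)
        + (I (\<lambda>t. dyadic_avg g n a b t - g t) + I (\<lambda>t. g t - f t))"
      by (intro add_left_mono tri) auto
    also have "\<dots> \<le> ennreal (e / 4) + (ennreal (e / 4) + ennreal (e / 4))"
      using Dfg[of n] Dg gf by (intro add_mono) auto
    also have "\<dots> = ennreal (3 * e / 4)"
      using e by (simp flip: ennreal_plus)
    also have "\<dots> < ennreal e"
      using e by (intro ennreal_lessI) auto
    finally show ?case by (simp add: I_def)
  qed
qed

text \<open>Fatou's lemma later asks only for pointwise convergence along some sequence of depths.
  L1 convergence provides this without a maximal function or a differentiation theorem.\<close>

lemma dyadic_avg_AE_subseq:
  assumes "loc_integrable f" "f \<in> borel_measurable borel" "a < b"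
  obtains r :: "nat \<Rightarrow> nat" where
    "AE t in lborel. t \<in> {a..<b} \<longrightarrow> (\<lambda>n. dyadic_avg f (r n) a b t) \<longlonglongrightarrow> f t"
proof -
  note assms(2) [measurable]
  define u where "u n t = indicator {a..<b} t *\<^sub>R (dyadic_avg f n a b t - f t)" for n t
  have [measurable]: "u n \<in> borel_measurable borel" for n
    unfolding u_def by measurable
  have nn: "(\<integral>\<^sup>+ t. ennreal (norm (u n t)) \<partial>lborel)
      = (\<integral>\<^sup>+ t\<in>{a..<b}. ennreal (norm (dyadic_avg f n a b t - f t)) \<partial>lborel)" for n
    by (intro nn_integral_cong) (auto simp: u_def split: split_indicator)
  have dn: "integrable lborel (\<lambda>t. indicator {a..<b} t *\<^sub>R dyadic_avg f n a b t)" for n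
  proof (rule integrableI_bounded)
    have "(\<integral>\<^sup>+ t. ennreal (norm (indicator {a..<b} t *\<^sub>R dyadic_avg f n a b t)) \<partial>lborel)
      = (\<integral>\<^sup>+ t\<in>{a..<b}. ennreal (norm (dyadic_avg f n a b t)) \<partial>lborel)"
      by (intro nn_integral_cong) (auto split: split_indicator)
    also have "\<dots> \<le> (\<integral>\<^sup>+ t\<in>{a..<b}. ennreal (norm (f t)) \<partial>lborel)"
      by (rule nn_integral_dyadic_avg_le[OF assms])
    also have "\<dots> < \<infinity>"
      by (subst nn_integral_eq_set_integral)
        (use loc_integrable_norm[OF assms(1)] in \<open>auto simp: loc_integrableD\<close>)
    finally show "(\<integral>\<^sup>+ t. ennreal (norm (indicator {a..<b} t *\<^sub>R dyadic_avg f n a b t)) \<partial>lborel) < \<infinity>" .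
  qed simp
  have int: "integrable lborel (u n)" for n
    using Bochner_Integration.integrable_diff[OF dn[of n]] loc_integrableD[OF assms(1), of a b]
    unfolding u_def set_integrable_def by (simp add: scaleR_diff_right)
  have "(\<lambda>n. ennreal (LINT t|lborel. norm (u n t))) \<longlonglongrightarrow> 0"
    using dyadic_avg_tendsto_L1[OF assms] int
    by (simp add: nn_integral_eq_integral flip: nn)
  then have "(\<lambda>n. (LINT t|lborel. norm (u n t))) \<longlonglongrightarrow> 0"
    by (simp add: ennreal_tendsto_0_iff)
  from tendsto_L1_AE_subseq[OF int this] obtain r where
    r: "AE t in lborel. (\<lambda>n. u (r n) t) \<longlonglongrightarrow> 0" by blast
  from r have "AE t in lborel. t \<in> {a..<b} \<longrightarrow> (\<lambda>n. dyadic_avg f (r n) a b t) \<longlonglongrightarrow> f t"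
  proof eventually_elim
    case (elim t)
    then show ?case
      by (auto simp: u_def intro: LIM_zero_cancel)
  qed
  then show ?thesis using that by blast
qed

section \<open>Muckenhoupt weights on the line\<close>

text \<open>Optimising over the scaling \<open>s\<close> turns a linear inequality between integrals
  into Cauchy--Schwarz. The choice is \<open>s = x / y\<close>; if \<open>y = 0\<close>, the choice
  \<open>(z + 1) / x\<close> shows that \<open>x\<close> cannot be positive.\<close>

lemma square_le_mult_of_am_gm:
  fixes x y z :: real
  assumes "0 \<le> x" "0 \<le> y" "0 \<le> z" "\<And>s. s > 0 \<Longrightarrow> 2 * x \<le> s * y + z / s"
  shows "x\<^sup>2 \<le> y * z"
proof (cases "x = 0")
  case False
  then have x: "x > 0" using assms by simp
  show ?thesis
  proof (cases "y = 0")
    case True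
    have "2 * x \<le> z / ((z + 1) / x)"
      using assms(4)[of "(z + 1) / x"] x assms(3) True by simp
    also have "\<dots> = x * (z / (z + 1))" by simp
    also have "\<dots> \<le> x * 1"
      using x assms(3) by (intro mult_left_mono) auto
    finally show ?thesis using x by simp
  next
    case False
    then have y: "y > 0" using assms by simp
    have "2 * x \<le> x / y * y + z / (x / y)"
      using assms(4)[of "x / y"] x y by simp
    then have "x \<le> z * y / x" using y by simp
    then show ?thesis using x by (simp add: field_simps power2_eq_square)
  qed
qed (use assms in auto)

text \<open>The averages of the A2 condition are multiplied out, and intervals go up to one full
  turn. Real division sets \<open>1 / 0 = 0\<close>; \<open>pos\<close> is what makes
  \<open>1 / v\<close> the genuine reciprocal almost everywhere.\<close>

locale A2_line =
  fixes v :: "real \<Rightarrow> real" and A :: real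
  assumes meas [measurable]: "v \<in> borel_measurable borel"
    and nonneg: "0 \<le> v t"
    and pos: "AE t in lborel. 0 < v t"
    and int: "loc_integrable v"
    and int_inv: "loc_integrable (\<lambda>t. 1 / v t)"
    and A2: "a < b \<Longrightarrow> b - a \<le> 2 * pi \<Longrightarrow>
      (LINT t:{a..<b}|lborel. v t) * (LINT t:{a..<b}|lborel. 1 / v t) \<le> A * (b - a)\<^sup>2"
begin

text \<open>The condition is symmetric in \<open>v\<close> and \<open>1 / v\<close>, so interpreting
  the locale once more makes every mass estimate available for the dual weight.\<close>

lemma dual: "A2_line (\<lambda>t. 1 / v t) A"
proof
  show "AE t in lborel. 0 < 1 / v t"
    using pos by simp
qed (use int int_inv nonneg A2 in \<open>auto simp: mult.commute\<close>)

definition mass :: "real set \<Rightarrow> real" where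
  "mass E = (LINT t:E|lborel. v t)"

lemma mass_nonneg: "0 \<le> mass E"
  unfolding mass_def by (rule set_integral_nonneg_real) (rule nonneg)

lemma mass_Un:
  assumes "E \<in> sets borel" "F \<in> sets borel" "E \<subseteq> {a..<b}" "F \<subseteq> {a..<b}" "E \<inter> F = {}"
  shows "mass (E \<union> F) = mass E + mass F"
  unfolding mass_def
  using assms by (intro set_integral_Un loc_integrable_subset[OF int]) auto

lemma mass_mono:
  assumes "E \<in> sets borel" "F \<in> sets borel" "E \<subseteq> F" "F \<subseteq> {a..<b}"
  shows "mass E \<le> mass F"
proof -
  have "mass (E \<union> (F - E)) = mass E + mass (F - E)"
    using assms by (intro mass_Un) auto
  moreover have "E \<union> (F - E) = F" using assms by auto
  ultimately show ?thesis using mass_nonneg[of "F - E"] by simp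
qed

lemma nn_integral_mass: "E \<in> sets borel \<Longrightarrow> E \<subseteq> {a..<b} \<Longrightarrow>
    (\<integral>\<^sup>+ t\<in>E. ennreal (v t) \<partial>lborel) = ennreal (mass E)"
  unfolding mass_def
  by (rule nn_integral_eq_set_integral) (auto intro: loc_integrable_subset[OF int] nonneg)

text \<open>Where \<open>v t\<close> is positive, completing the square bounds
  \<open>2 * g t\<close> by \<open>s * ((g t)\<^sup>2 * v t) + 1 / (s * v t)\<close>. Integration
  followed by optimisation over \<open>s\<close> gives the product.\<close>

lemma cauchy_schwarz:
  assumes E: "E \<in> sets borel" "E \<subseteq> {a..<b}" and g: "set_integrable lborel E g"
    "set_integrable lborel E (\<lambda>t. (g t)\<^sup>2 * v t)" "\<And>t. 0 \<le> g t"
  shows "(LINT t:E|lborel. g t)\<^sup>2 \<le> (LINT t:E|lborel. (g t)\<^sup>2 * v t) * (LINT t:E|lborel. 1 / v t)"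
proof (rule square_le_mult_of_am_gm)
  fix s :: real assume s: "s > 0"
  have i: "set_integrable lborel E (\<lambda>t. 1 / v t)"
    using E by (rule loc_integrable_subset[OF int_inv])
  have i': "set_integrable lborel E (\<lambda>t. (1 / v t) / s)"
    using i by (rule set_integrable_divide)
  have "2 * (LINT t:E|lborel. g t) = (LINT t:E|lborel. 2 * g t)" by simp
  also have "\<dots> \<le> (LINT t:E|lborel. s * ((g t)\<^sup>2 * v t) + (1 / v t) / s)"
  proof (rule set_integral_mono_AE)
    show "AE t\<in>E in lborel. 2 * g t \<le> s * ((g t)\<^sup>2 * v t) + 1 / v t / s"
      using pos
    proof eventually_elim
      case (elim t)
      have "0 \<le> (s * g t * v t - 1)\<^sup>2 / (s * v t)"
        using elim s by simp
      also have "\<dots> = s * ((g t)\<^sup>2 * v t) + 1 / v t / s - 2 * g t"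
        using elim s by (simp add: field_simps power2_eq_square)
      finally show ?case by simp
    qed
  qed (use i' g in \<open>auto intro!: set_integral_add simp del: divide_divide_eq_left\<close>)
  also have "\<dots> = s * (LINT t:E|lborel. (g t)\<^sup>2 * v t) + (LINT t:E|lborel. 1 / v t) / s"
    using i' g by (subst set_integral_add) (auto simp del: divide_divide_eq_left)
  finally show "2 * (LINT t:E|lborel. g t)
      \<le> s * (LINT t:E|lborel. (g t)\<^sup>2 * v t) + (LINT t:E|lborel. 1 / v t) / s" .
qed (auto intro!: set_integral_nonneg_real g(3) nonneg mult_nonneg_nonneg)

lemma measure_square_le:
  assumes "E \<in> sets borel" "E \<subseteq> {a..<b}"
  shows "(measure lborel E)\<^sup>2 \<le> mass E * (LINT t:E|lborel. 1 / v t)"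
proof -
  have fin: "emeasure lborel E \<noteq> \<infinity>"
  proof -
    have "emeasure lborel E \<le> emeasure lborel {a..<b}"
      using assms by (intro emeasure_mono) auto
    also have "\<dots> < \<infinity>" by (cases "a \<le> b") auto
    finally show ?thesis by simp
  qed
  have "(LINT t:E|lborel. 1 :: real) = measure lborel E"
    using assms fin by (simp add: set_integral_const)
  then show ?thesis
    using cauchy_schwarz[of E a b "\<lambda>_. 1"] assms
    by (simp add: mass_def set_integrable_const_subset loc_integrable_subset[OF int])
qed

lemma length_square_le:
  assumes "a < b"
  shows "(b - a)\<^sup>2 \<le> mass {a..<b} * (LINT t:{a..<b}|lborel. 1 / v t)"
  using measure_square_le[of "{a..<b}" a b] assms by simp

lemma mass_pos: "a < b \<Longrightarrow> 0 < mass {a..<b}"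
  using length_square_le[of a b] mass_nonneg[of "{a..<b}"]
  by (smt (verit) mult_eq_0_iff zero_less_power zero_less_mult_iff)

text \<open>On the unit interval, Cauchy--Schwarz bounds the product of the two integrals below by 1
  and the A2 condition bounds it above by \<open>A\<close>.\<close>

lemma A_ge_1: "1 \<le> A"
  using order_trans[OF length_square_le[of 0 1, unfolded mass_def] A2[of 0 1]] pi_gt3 by simp

text \<open>Quantitative absolute continuity: a set with a fixed fraction of the length carries a
  fixed fraction of the mass. Cauchy--Schwarz is applied on \<open>E\<close>, the dual mass of
  \<open>E\<close> is enlarged to that of the interval, and the A2 condition removes it.\<close>

lemma measure_square_mass_le:
  assumes "E \<in> sets borel" "E \<subseteq> {a..<b}" "a < b" "b - a \<le> 2 * pi"
  shows "(measure lborel E)\<^sup>2 * mass {a..<b} \<le> A * mass E * (b - a)\<^sup>2"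
proof -
  interpret D: A2_line "\<lambda>t. 1 / v t" A by (rule dual)
  have "(measure lborel E)\<^sup>2 \<le> mass E * D.mass E"
    using measure_square_le[OF assms(1,2)] by (simp add: D.mass_def)
  also have "\<dots> \<le> mass E * D.mass {a..<b}"
    using assms by (intro mult_left_mono D.mass_mono[of _ _ a b] mass_nonneg) auto
  finally have "(measure lborel E)\<^sup>2 * mass {a..<b} \<le> mass E * (mass {a..<b} * D.mass {a..<b})"
    using mult_right_mono[OF _ mass_nonneg] by (metis mult.assoc mult.commute)
  also have "\<dots> \<le> mass E * (A * (b - a)\<^sup>2)"
    using A2[OF assms(3,4)] by (intro mult_left_mono mass_nonneg) (simp add: mass_def D.mass_def)
  finally show ?thesis by (simp add: ac_simps)
qed

text \<open>The complement of \<open>E\<close> has at least half the length, so it has a definite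
  share of the mass; squaring the half gives the 4 in \<open>4 * A\<close>. This is applied both to
  stopping sets and to concentric halves of arcs.\<close>

lemma mass_half_le:
  assumes E: "E \<in> sets borel" "E \<subseteq> {a..<b}" and ab: "a < b" "b - a \<le> 2 * pi"
    and half: "2 * measure lborel E \<le> b - a"
  shows "mass E \<le> (1 - 1 / (4 * A)) * mass {a..<b}"
proof -
  have fin: "emeasure lborel {a..<b} \<noteq> \<infinity>" using ab by simp
  have "measure lborel ({a..<b} - E) = (b - a) - measure lborel E"
    using measure_Diff[OF fin, of E] E ab by simp
  then have "(b - a) / 2 \<le> measure lborel ({a..<b} - E)"
    using half by simp
  then have "((b - a) / 2)\<^sup>2 \<le> (measure lborel ({a..<b} - E))\<^sup>2"
    using ab by (intro power_mono) auto
  then have "((b - a) / 2)\<^sup>2 * mass {a..<b} \<le> A * mass ({a..<b} - E) * (b - a)\<^sup>2"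
    using measure_square_mass_le[of "{a..<b} - E" a b] E ab mass_nonneg
    by (smt (verit) Diff_subset mult_right_mono sets.Diff atLeastLessThan_borel)
  then have "(b - a)\<^sup>2 * (mass {a..<b} / (4 * A)) \<le> (b - a)\<^sup>2 * mass ({a..<b} - E)"
    using A_ge_1 by (simp add: field_simps power2_eq_square)
  then have "mass {a..<b} / (4 * A) \<le> mass ({a..<b} - E)"
    by (rule mult_left_le_imp_le) (use ab in simp)
  moreover have "mass (E \<union> ({a..<b} - E)) = mass E + mass ({a..<b} - E)"
    using E by (intro mass_Un[of _ _ a b]) auto
  moreover have "E \<union> ({a..<b} - E) = {a..<b}" using E by auto
  ultimately show ?thesis by (simp add: algebra_simps add_divide_distrib)
qed

subsection \<open>A weighted John--Nirenberg inequality\<close>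

text \<open>The squared distance in weighted L2 between \<open>c\<close> and the dyadic average of
  depth \<open>n\<close>. Being a real finite sum, it lets the induction proceed without any
  possibly infinite integral.\<close>

fun leaf_sum :: "(real \<Rightarrow> complex) \<Rightarrow> nat \<Rightarrow> real \<Rightarrow> real \<Rightarrow> complex \<Rightarrow> real" where
  "leaf_sum f 0 a b c = (norm (avg f a b - c))\<^sup>2 * mass {a..<b}"
| "leaf_sum f (Suc n) a b c = leaf_sum f n a ((a + b) / 2) c + leaf_sum f n ((a + b) / 2) b c"

lemma mass_split:
  assumes "a \<le> m" "m \<le> b"
  shows "mass {a..<b} = mass {a..<m} + mass {m..<b}"
  unfolding mass_def by (rule set_integral_split[OF int assms])

text \<open>Young's inequality with a free parameter, so that the coefficient of the recentred sum
  can be taken close to 1. A coefficient 2 would not be compensated by the share of mass on the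
  stopping set, which may be as large as \<open>1 - 1 / (4 * A)\<close>.\<close>

lemma leaf_sum_shift:
  assumes "a < b" "\<eta> > 0"
  shows "leaf_sum f n a b c
    \<le> (1 + \<eta>) * leaf_sum f n a b d + (1 + 1 / \<eta>) * (norm (d - c))\<^sup>2 * mass {a..<b}"
  using assms(1)
proof (induction n arbitrary: a b)
  case 0
  define x y where "x = norm (avg f a b - d)" and "y = norm (d - c)"
  have "norm (avg f a b - c) \<le> x + y"
    unfolding x_def y_def by (rule norm_diff_triangle_le) auto
  then have "(norm (avg f a b - c))\<^sup>2 \<le> (x + y)\<^sup>2"
    by (intro power_mono) auto
  also have "\<dots> \<le> (1 + \<eta>) * x\<^sup>2 + (1 + 1 / \<eta>) * y\<^sup>2"
  proof -
    have "0 \<le> (\<eta> * x - y)\<^sup>2 / \<eta>" using assms by simp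
    also have "\<dots> = (1 + \<eta>) * x\<^sup>2 + (1 + 1 / \<eta>) * y\<^sup>2 - (x + y)\<^sup>2"
      using assms by (simp add: field_simps power2_eq_square)
    finally show ?thesis by simp
  qed
  finally have "(norm (avg f a b - c))\<^sup>2 * mass {a..<b}
      \<le> ((1 + \<eta>) * x\<^sup>2 + (1 + 1 / \<eta>) * y\<^sup>2) * mass {a..<b}"
    by (rule mult_right_mono) (rule mass_nonneg)
  then show ?case
    by (simp add: x_def y_def algebra_simps)
next
  case (Suc n)
  define m where "m = (a + b) / 2"
  have m: "a < m" "m < b" using Suc.prems by (auto simp: m_def)
  have s: "mass {a..<b} = mass {a..<m} + mass {m..<b}"
    using m by (intro mass_split) auto
  show ?case
    using Suc.IH[OF m(1)] Suc.IH[OF m(2)]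
    by (simp add: s flip: m_def) (simp add: algebra_simps)
qed

text \<open>The set \<open>E\<close> is the union of the Calderon--Zygmund stopping intervals, i.e. the maximal
  dyadic subintervals on which the mean of \<open>|f - c|\<close> exceeds \<open>2 B\<close>.\<close>

lemma leaf_sum_stopping:
  assumes f: "loc_integrable f" and ab: "a < b" "b - a \<le> 2 * pi" and B: "B > 0" and \<eta>: "\<eta> > 0"
    and start: "(LINT t:{a..<b}|lborel. norm (f t - c)) \<le> 2 * B * (b - a)"
    and IH: "\<And>m a b. m < n \<Longrightarrow> a < b \<Longrightarrow> b - a \<le> 2 * pi \<Longrightarrow>
      leaf_sum f m a b (avg f a b) \<le> K * mass {a..<b}"
  shows "\<exists>E\<in>sets borel. E \<subseteq> {a..<b} \<and>
    2 * B * measure lborel E \<le> (LINT t:E|lborel. norm (f t - c)) \<and>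
    leaf_sum f n a b c \<le> 4 * B\<^sup>2 * mass {a..<b} + ((1 + \<eta>) * K + (1 + 1 / \<eta>) * 16 * B\<^sup>2) * mass E"
  \<comment> \<open>The interval varies in the induction while \<open>c\<close> stays fixed; the
    centre changes only on stopping intervals.\<close>
  using ab start IH
proof (induction n arbitrary: a b)
  case 0
  have "norm (avg f a b - c) * (b - a) \<le> 2 * B * (b - a)"
    using norm_avg_minus_le[OF 0(1) f, of c] 0(3) by simp
  then have "norm (avg f a b - c) \<le> 2 * B"
    using 0(1) by simp
  then have "(norm (avg f a b - c))\<^sup>2 \<le> (2 * B)\<^sup>2"
    by (intro power_mono) auto
  then have "leaf_sum f 0 a b c \<le> 4 * B\<^sup>2 * mass {a..<b}"
    using mult_right_mono[OF _ mass_nonneg] by (fastforce simp: power_mult_distrib)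
  \<comment> \<open>At depth 0 the hypothesis \<open>start\<close> already bounds the mean, so
    nothing is stopped.\<close>
  then show ?case
    by (intro bexI[of _ "{}"]) (auto simp: mass_def set_lebesgue_integral_def)
next
  case (Suc n)
  define L where "L = (1 + \<eta>) * K + (1 + 1 / \<eta>) * 16 * B\<^sup>2"
  define m where "m = (a + b) / 2"
  have m: "a < m" "m < b" "m - a = (b - a) / 2" "b - m = (b - a) / 2"
    using Suc.prems(1) by (auto simp: m_def field_simps)
  have nfc: "loc_integrable (\<lambda>t. norm (f t - c))"
    using f by (intro loc_integrable_norm loc_integrable_diff) auto
  have I: "(LINT t:{a..<b}|lborel. norm (f t - c))
      = (LINT t:{a..<m}|lborel. norm (f t - c)) + (LINT t:{m..<b}|lborel. norm (f t - c))"
    using m by (intro set_integral_split nfc) auto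
  have nn: "0 \<le> (LINT t:{x..<y}|lborel. norm (f t - c))" for x y
    by (rule set_integral_nonneg_real) simp
  have half: "\<exists>E\<in>sets borel. E \<subseteq> {x..<y} \<and>
      2 * B * measure lborel E \<le> (LINT t:E|lborel. norm (f t - c)) \<and>
      leaf_sum f n x y c \<le> 4 * B\<^sup>2 * mass {x..<y} + L * mass E"
    if xy: "x < y" "y - x = (b - a) / 2" and
      le: "(LINT t:{x..<y}|lborel. norm (f t - c)) \<le> 2 * B * (b - a)" for x y
  proof (cases "(LINT t:{x..<y}|lborel. norm (f t - c)) \<le> 2 * B * (y - x)")
    case True
    show ?thesis
      unfolding L_def by (rule Suc.IH[OF xy(1) _ True]) (use xy Suc.prems in auto)
  next
    \<comment> \<open>This half is a stopping interval and becomes part of \<open>E\<close>. Its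
      parent was not stopped, so the mean of |f - c| over it is at most twice the height, that is
      \<open>4 * B\<close>.\<close>
    case False
    have "4 * B * (y - x) = 2 * B * (b - a)"
      unfolding xy(2) by simp
    then have "norm (avg f x y - c) * (y - x) \<le> 4 * B * (y - x)"
      using norm_avg_minus_le[OF xy(1) f, of c] le by linarith
    then have "norm (avg f x y - c) \<le> 4 * B"
      by (rule mult_right_le_imp_le) (use xy in simp)
    then have sq: "(norm (avg f x y - c))\<^sup>2 \<le> 16 * B\<^sup>2"
      using power_mono[of "norm (avg f x y - c)" "4 * B" 2] by (simp add: power_mult_distrib)
    \<comment> \<open>Inside a stopping interval the centre moves to the interval's own mean, where
      the bound for smaller depths applies.\<close>
    have "leaf_sum f n x y c \<le> (1 + \<eta>) * leaf_sum f n x y (avg f x y)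
        + (1 + 1 / \<eta>) * (norm (avg f x y - c))\<^sup>2 * mass {x..<y}"
      by (rule leaf_sum_shift[OF xy(1) \<eta>])
    also have "\<dots> \<le> (1 + \<eta>) * (K * mass {x..<y}) + (1 + 1 / \<eta>) * (16 * B\<^sup>2) * mass {x..<y}"
      using Suc.prems(4)[of n x y] xy Suc.prems \<eta> sq
      by (intro add_mono mult_left_mono mult_right_mono mass_nonneg) auto
    also have "\<dots> \<le> 4 * B\<^sup>2 * mass {x..<y} + L * mass {x..<y}"
      using mass_nonneg[of "{x..<y}"] by (simp add: L_def algebra_simps)
    finally show ?thesis
      using False xy(1) by (intro bexI[of _ "{x..<y}"]) auto
  qed
  obtain E1 where E1: "E1 \<in> sets borel" "E1 \<subseteq> {a..<m}"
      "2 * B * measure lborel E1 \<le> (LINT t:E1|lborel. norm (f t - c))"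
      "leaf_sum f n a m c \<le> 4 * B\<^sup>2 * mass {a..<m} + L * mass E1"
    using half[of a m] m I Suc.prems(3) nn[of m b] by auto
  obtain E2 where E2: "E2 \<in> sets borel" "E2 \<subseteq> {m..<b}"
      "2 * B * measure lborel E2 \<le> (LINT t:E2|lborel. norm (f t - c))"
      "leaf_sum f n m b c \<le> 4 * B\<^sup>2 * mass {m..<b} + L * mass E2"
    using half[of m b] m I Suc.prems(3) nn[of a m] by auto
  have sub: "E1 \<subseteq> {a..<b}" "E2 \<subseteq> {a..<b}" "E1 \<inter> E2 = {}"
    using E1 E2 m by force+
  have fin: "emeasure lborel E \<noteq> \<infinity>" if "E \<subseteq> {a..<b}" for E
    using emeasure_mono[OF that, of lborel] Suc.prems(1) by (auto simp: top_unique)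
  have "measure lborel (E1 \<union> E2) = measure lborel E1 + measure lborel E2"
    using E1(1) E2(1) sub fin by (intro measure_Union) auto
  moreover have "(LINT t:E1\<union>E2|lborel. norm (f t - c))
      = (LINT t:E1|lborel. norm (f t - c)) + (LINT t:E2|lborel. norm (f t - c))"
    using E1 E2 sub by (intro set_integral_Un loc_integrable_subset[OF nfc]) auto
  moreover have "mass (E1 \<union> E2) = mass E1 + mass E2"
    using E1 E2 sub by (intro mass_Un[of _ _ a b]) auto
  moreover have "mass {a..<b} = mass {a..<m} + mass {m..<b}"
    using m by (intro mass_split) auto
  moreover have "leaf_sum f (Suc n) a b c = leaf_sum f n a m c + leaf_sum f n m b c"
    by (simp add: m_def)
  ultimately show ?case
    unfolding L_def[symmetric] using E1 E2 sub
    by (intro bexI[of _ "E1 \<union> E2"]) (auto simp: algebra_simps simp del: leaf_sum.simps)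
qed

text \<open>The balance of the induction,
  \<open>4 * B\<^sup>2 + (1 + 8 * A) * 16 * B\<^sup>2 = K / (8 * A)\<close>, solved for
  \<open>K\<close> and divided by \<open>B\<^sup>2\<close>.\<close>

definition JN_const :: real where
  "JN_const = 8 * A * (4 + 16 * (1 + 8 * A))"

lemma JN_const_nonneg: "0 \<le> JN_const"
  using A_ge_1 by (simp add: JN_const_def)

text \<open>The induction on the depth is strong because stopping intervals occur in every
  generation and leave any smaller depth below them. It closes thanks to the fraction
  \<open>\<delta>\<close> of the mass that lies outside the stopping set.\<close>

lemma leaf_sum_le:
  assumes f: "loc_integrable f" and B: "B > 0"
    and osc: "\<And>a b. a < b \<Longrightarrow> b - a \<le> 2 * pi \<Longrightarrow>
      (LINT t:{a..<b}|lborel. norm (f t - avg f a b)) \<le> B * (b - a)"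
    and ab: "a < b" "b - a \<le> 2 * pi"
  shows "leaf_sum f n a b (avg f a b) \<le> JN_const * B\<^sup>2 * mass {a..<b}"
  using ab
proof (induction n arbitrary: a b rule: less_induct)
  case (less n)
  define \<delta> where "\<delta> = 1 / (4 * A)"
  have \<delta>: "0 < \<delta>" "\<delta> < 1" using A_ge_1 by (auto simp: \<delta>_def)
  define K where "K = JN_const * B\<^sup>2"
  have K0: "0 \<le> K" using JN_const_nonneg by (simp add: K_def)
  have start: "(LINT t:{a..<b}|lborel. norm (f t - avg f a b)) \<le> 2 * B * (b - a)"
    using osc[OF less.prems] B less.prems by (smt (verit) mult_right_mono)
  \<comment> \<open>Young's parameter is \<open>\<delta> / 2\<close>. Half of the gain pays for
    recentring, as \<open>(1 + \<delta> / 2) * (1 - \<delta>)\<close> is at most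
    \<open>1 - \<delta> / 2\<close>; the other half absorbs the constant terms.\<close>
  obtain E where E: "E \<in> sets borel" "E \<subseteq> {a..<b}"
      "2 * B * measure lborel E \<le> (LINT t:E|lborel. norm (f t - avg f a b))"
      "leaf_sum f n a b (avg f a b) \<le> 4 * B\<^sup>2 * mass {a..<b}
        + ((1 + \<delta> / 2) * K + (1 + 1 / (\<delta> / 2)) * 16 * B\<^sup>2) * mass E"
    using leaf_sum_stopping[OF f less.prems B _ start, of "\<delta> / 2" n K] \<delta> less.IH
    unfolding K_def by auto
  have nfc: "loc_integrable (\<lambda>t. norm (f t - avg f a b))"
    using f by (intro loc_integrable_norm loc_integrable_diff) auto
  have "(LINT t:E|lborel. norm (f t - avg f a b)) \<le> (LINT t:{a..<b}|lborel. norm (f t - avg f a b))"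
  proof -
    have "(LINT t:E\<union>({a..<b} - E)|lborel. norm (f t - avg f a b))
        = (LINT t:E|lborel. norm (f t - avg f a b)) + (LINT t:{a..<b} - E|lborel. norm (f t - avg f a b))"
      using E by (intro set_integral_Un loc_integrable_subset[OF nfc, of _ a b]) auto
    moreover have "E \<union> ({a..<b} - E) = {a..<b}" using E by auto
    moreover have "0 \<le> (LINT t:{a..<b} - E|lborel. norm (f t - avg f a b))"
      by (rule set_integral_nonneg_real) simp
    ultimately show ?thesis by simp
  qed
  also have "\<dots> \<le> B * (b - a)" by (rule osc[OF less.prems])
  \<comment> \<open>Chebyshev's inequality: the integral over \<open>E\<close> is at least
    \<open>2 * B\<close> times the length of \<open>E\<close>, that over the whole interval at most
    \<open>B\<close> times its length.\<close>
  finally have "B * (2 * measure lborel E) \<le> B * (b - a)" using E(3) by simp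
  then have "2 * measure lborel E \<le> b - a" using B by simp
  then have half: "mass E \<le> (1 - \<delta>) * mass {a..<b}"
    unfolding \<delta>_def by (rule mass_half_le[OF E(1,2) less.prems])
  have "4 * B\<^sup>2 + ((1 + \<delta> / 2) * K + (1 + 1 / (\<delta> / 2)) * 16 * B\<^sup>2) * (1 - \<delta>) \<le> K"
  proof -
    define X where "X = (1 + 1 / (\<delta> / 2)) * 16 * B\<^sup>2"
    have "(1 + \<delta> / 2) * (1 - \<delta>) \<le> 1 - \<delta> / 2"
      using \<delta> by (simp add: algebra_simps)
    from mult_right_mono[OF this K0] have "(1 + \<delta> / 2) * (1 - \<delta>) * K \<le> K - \<delta> / 2 * K"
      by (simp add: left_diff_distrib)
    moreover have "0 \<le> X * \<delta>"
      unfolding X_def using \<delta> by simp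
    moreover have "4 * B\<^sup>2 + X = \<delta> / 2 * K"
      using A_ge_1 by (simp add: X_def \<delta>_def K_def JN_const_def field_simps)
    moreover have "4 * B\<^sup>2 + ((1 + \<delta> / 2) * K + X) * (1 - \<delta>)
        = (4 * B\<^sup>2 + X) + (1 + \<delta> / 2) * (1 - \<delta>) * K - X * \<delta>"
      by (simp add: algebra_simps)
    ultimately have "4 * B\<^sup>2 + ((1 + \<delta> / 2) * K + X) * (1 - \<delta>) \<le> K"
      by linarith
    then show ?thesis unfolding X_def .
  qed
  from mult_right_mono[OF this mass_nonneg[of "{a..<b}"]]
  have "4 * B\<^sup>2 * mass {a..<b}
      + ((1 + \<delta> / 2) * K + (1 + 1 / (\<delta> / 2)) * 16 * B\<^sup>2) * ((1 - \<delta>) * mass {a..<b}) \<le> K * mass {a..<b}"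
    by (simp only: distrib_right mult.assoc)
  moreover have "((1 + \<delta> / 2) * K + (1 + 1 / (\<delta> / 2)) * 16 * B\<^sup>2) * mass E
      \<le> ((1 + \<delta> / 2) * K + (1 + 1 / (\<delta> / 2)) * 16 * B\<^sup>2) * ((1 - \<delta>) * mass {a..<b})"
    using half K0 \<delta> by (intro mult_left_mono) auto
  ultimately show ?case
    using E(4) unfolding K_def by linarith
qed

lemma leaf_sum_eq_nn_integral:
  assumes "a < b"
  shows "(\<integral>\<^sup>+ t\<in>{a..<b}. ennreal ((norm (dyadic_avg f n a b t - c))\<^sup>2) * ennreal (v t) \<partial>lborel)
    = ennreal (leaf_sum f n a b c)"
  using assms
proof (induction n arbitrary: a b)
  case 0
  have "(\<integral>\<^sup>+ t\<in>{a..<b}. ennreal ((norm (avg f a b - c))\<^sup>2) * ennreal (v t) \<partial>lborel)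
      = ennreal ((norm (avg f a b - c))\<^sup>2) * (\<integral>\<^sup>+ t\<in>{a..<b}. ennreal (v t) \<partial>lborel)"
    by (simp add: mult.assoc nn_integral_cmult)
  then show ?case
    by (simp add: nn_integral_mass[of _ a b] ennreal_mult mass_nonneg)
next
  case (Suc n)
  have nn: "0 \<le> leaf_sum f n x y c" for x y
    by (induction n arbitrary: x y) (auto simp: mass_nonneg)
  show ?case
    using nn_integral_dyadic_split[of "\<lambda>x. ennreal ((norm (x - c))\<^sup>2)" a b "(a + b) / 2" "\<lambda>t. ennreal (v t)" f n]
      Suc.IH[of a "(a + b) / 2"] Suc.IH[of "(a + b) / 2" b] Suc.prems
    by (simp add: nn)
qed

text \<open>The bounds at finite depth share one constant, so Fatou's lemma along an almost
  everywhere convergent subsequence of depths carries them to \<open>f\<close>. Finiteness of the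
  integral is part of the conclusion.\<close>

theorem weighted_john_nirenberg:
  assumes f: "loc_integrable f" and [measurable]: "f \<in> borel_measurable borel" and B: "B > 0"
    and osc: "\<And>a b. a < b \<Longrightarrow> b - a \<le> 2 * pi \<Longrightarrow>
      (LINT t:{a..<b}|lborel. norm (f t - avg f a b)) \<le> B * (b - a)"
    and ab: "a < b" "b - a \<le> 2 * pi"
  shows "(\<integral>\<^sup>+ t\<in>{a..<b}. ennreal ((norm (f t - avg f a b))\<^sup>2 * v t) \<partial>lborel)
    \<le> ennreal (JN_const * B\<^sup>2 * mass {a..<b})"
proof -
  define c where "c = avg f a b"
  obtain r where r: "AE t in lborel. t \<in> {a..<b} \<longrightarrow> (\<lambda>n. dyadic_avg f (r n) a b t) \<longlonglongrightarrow> f t"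
    using dyadic_avg_AE_subseq[OF f _ ab(1)] by auto
  define h where "h n t = ennreal ((norm (dyadic_avg f (r n) a b t - c))\<^sup>2 * v t) * indicator {a..<b} t" for n t
  have [measurable]: "h n \<in> borel_measurable borel" for n
    unfolding h_def by measurable
  have hn: "(\<integral>\<^sup>+ t. h n t \<partial>lborel) \<le> ennreal (JN_const * B\<^sup>2 * mass {a..<b})" for n
  proof -
    have "(\<integral>\<^sup>+ t. h n t \<partial>lborel) = ennreal (leaf_sum f (r n) a b c)"
      unfolding h_def by (simp add: ennreal_mult nonneg flip: leaf_sum_eq_nn_integral[OF ab(1)])
    then show ?thesis
      using leaf_sum_le[OF f B osc ab] by (simp add: c_def ennreal_leI)
  qed
  have "(\<integral>\<^sup>+ t\<in>{a..<b}. ennreal ((norm (f t - c))\<^sup>2 * v t) \<partial>lborel) = (\<integral>\<^sup>+ t. liminf (\<lambda>n. h n t) \<partial>lborel)"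
  proof (rule nn_integral_cong_AE)
    show "AE t in lborel. ennreal ((norm (f t - c))\<^sup>2 * v t) * indicator {a..<b} t = liminf (\<lambda>n. h n t)"
      using r
    proof eventually_elim
      case (elim t)
      show ?case
      proof (cases "t \<in> {a..<b}")
        case True
        have "(\<lambda>n. ennreal ((norm (dyadic_avg f (r n) a b t - c))\<^sup>2 * v t)) \<longlonglongrightarrow> ennreal ((norm (f t - c))\<^sup>2 * v t)"
          using elim True by (intro tendsto_intros) auto
        then have "(\<lambda>n. h n t) \<longlonglongrightarrow> ennreal ((norm (f t - c))\<^sup>2 * v t)"
          using True by (simp add: h_def)
        then show ?thesis
          using True lim_imp_Liminf[OF sequentially_bot] by fastforce
      next
        case False
        then show ?thesis by (simp add: h_def Liminf_const)
      qed
    qed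
  qed
  also have "\<dots> \<le> liminf (\<lambda>n. \<integral>\<^sup>+ t. h n t \<partial>lborel)"
    by (rule nn_integral_liminf) simp
  also have "\<dots> \<le> ennreal (JN_const * B\<^sup>2 * mass {a..<b})"
  proof -
    have "liminf (\<lambda>n. \<integral>\<^sup>+ t. h n t \<partial>lborel) \<le> liminf (\<lambda>n. ennreal (JN_const * B\<^sup>2 * mass {a..<b}))"
      by (intro Liminf_mono) (simp add: hn)
    then show ?thesis by (simp add: Liminf_const)
  qed
  finally show ?thesis by (simp add: c_def)
qed

end

section \<open>The Poisson kernel\<close>

text \<open>For \<open>y = x / 2\<close>, at most pi / 4, both \<open>cos y\<close> and, by the mean
  value theorem, \<open>sin y / y\<close> are at least \<open>sqrt 2 / 2\<close>. The double angle
  formula multiplies the two.\<close>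

lemma sin_ge_half:
  assumes "0 \<le> x" "x \<le> pi / 2"
  shows "x / 2 \<le> sin (x::real)"
proof -
  define y where "y = x / 2"
  have y: "0 \<le> y" "y \<le> pi / 4" using assms by (auto simp: y_def)
  have c: "sqrt 2 / 2 \<le> cos u" if "0 \<le> u" "u \<le> pi / 4" for u
    using cos_monotone_0_pi_le[of u "pi / 4"] that pi_gt_zero by (simp add: cos_45)
  have "y * (sqrt 2 / 2) \<le> sin y"
  proof (cases "y = 0")
    case False
    then have "y > 0" using y by simp
    then obtain u where u: "0 < u" "u < y" "sin y - sin 0 = (y - 0) * cos u"
      using MVT2[of 0 y sin cos] by (auto intro: DERIV_sin)
    then show ?thesis
      using c[of u] y by (simp add: mult_left_mono)
  qed simp
  moreover have "0 \<le> y * (sqrt 2 / 2)" using y by simp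
  ultimately have "(y * (sqrt 2 / 2)) * (sqrt 2 / 2) \<le> sin y * cos y"
    using c[OF y] by (intro mult_mono) auto
  moreover have "(y * (sqrt 2 / 2)) * (sqrt 2 / 2) = x / 4"
    by (simp add: y_def)
  moreover have "sin x = 2 * sin y * cos y"
    using sin_double[of y] by (simp add: y_def)
  ultimately show ?thesis by linarith
qed

lemma one_minus_cos_ge:
  assumes "\<bar>s\<bar> \<le> pi"
  shows "s\<^sup>2 / 8 \<le> 1 - cos (s::real)"
proof -
  have "\<bar>s\<bar> / 4 \<le> sin (\<bar>s\<bar> / 2)"
    using sin_ge_half[of "\<bar>s\<bar> / 2"] assms by simp
  then have "(\<bar>s\<bar> / 4)\<^sup>2 \<le> (sin (\<bar>s\<bar> / 2))\<^sup>2"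
    by (intro power_mono) auto
  then have "s\<^sup>2 / 8 \<le> 2 * (sin (\<bar>s\<bar> / 2))\<^sup>2"
    by (simp add: power_divide)
  also have "\<dots> = 1 - cos \<bar>s\<bar>"
    using cos_double_sin[of "\<bar>s\<bar> / 2"] by simp
  finally show ?thesis by simp
qed

lemma poisson_kernel_polar:
  "poisson_kernel (of_real r * cis \<theta>) (cis t) = (1 - r\<^sup>2) / (1 - 2 * r * cos (t - \<theta>) + r\<^sup>2)"
proof -
  have "cnj (of_real r * cis \<theta>) * cis t = of_real r * cis (t - \<theta>)"
    by (simp add: cis_cnj cis_mult)
  moreover have "(cmod (1 - of_real r * cis s))\<^sup>2 = 1 - 2 * r * cos s + r\<^sup>2" for s
  proof -
    have "(cmod (1 - of_real r * cis s))\<^sup>2 = 1 - 2 * r * cos s + r\<^sup>2 * ((sin s)\<^sup>2 + (cos s)\<^sup>2)"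
      unfolding cmod_power2 by (simp add: power2_eq_square algebra_simps del: sin_cos_squared_add3)
    then show ?thesis by simp
  qed
  moreover have "(cmod (of_real r * cis \<theta>))\<^sup>2 = r\<^sup>2"
    by (simp add: norm_mult)
  ultimately show ?thesis
    unfolding poisson_kernel_def by metis
qed

text \<open>The Poisson kernel in polar form: \<open>r\<close> is the modulus of \<open>z\<close>
  and \<open>s\<close> the angle from \<open>z\<close> to the boundary point.\<close>

definition pker :: "real \<Rightarrow> real \<Rightarrow> real" where
  "pker r s = (1 - r\<^sup>2) / (1 - 2 * r * cos s + r\<^sup>2)"

lemma pker_denom:
  fixes r s :: real
  shows "1 - 2 * r * cos s + r\<^sup>2 = (1 - r)\<^sup>2 + 2 * r * (1 - cos s)"
  by (simp add: power2_eq_square algebra_simps)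

lemma pker_denom_ge:
  fixes r s :: real
  assumes "0 \<le> r"
  shows "(1 - r)\<^sup>2 \<le> 1 - 2 * r * cos s + r\<^sup>2"
  unfolding pker_denom using assms by simp

lemma pker_measurable [measurable]: "pker r \<in> borel_measurable borel"
  unfolding pker_def[abs_def] by measurable

lemma pker_nonneg: "0 \<le> r \<Longrightarrow> r < 1 \<Longrightarrow> 0 \<le> pker r s"
  unfolding pker_def
  by (intro divide_nonneg_nonneg order_trans[OF _ pker_denom_ge]) (auto simp: power_le_one)

lemma pker_le:
  assumes "0 \<le> r" "r < 1"
  shows "pker r s \<le> 2 / (1 - r)"
proof -
  have "pker r s \<le> (1 - r\<^sup>2) / (1 - r)\<^sup>2"
    unfolding pker_def using assms
    by (intro divide_left_mono pker_denom_ge mult_pos_pos less_le_trans[OF _ pker_denom_ge])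
      (auto simp: power_le_one)
  also have "\<dots> = (1 + r) / (1 - r)"
    using assms by (simp add: divide_simps) (simp add: power2_eq_square algebra_simps)
  also have "\<dots> \<le> 2 / (1 - r)"
    using assms by (intro divide_right_mono) auto
  finally show ?thesis .
qed

text \<open>The denominator is a sum of two nonnegative terms. For \<open>r < 1 / 2\<close> the term
  \<open>(1 - r)\<^sup>2\<close> is at least 1/4 and suffices because |s| < 4; otherwise
  \<open>1 - cos s\<close> has a coefficient of at least 1. The constant 64 covers both cases, and
  \<open>1 + r \<le> 2\<close> doubles it.\<close>

lemma pker_le_far:
  assumes r: "0 \<le> r" "r < 1" and s: "\<bar>s\<bar> \<le> pi" "s \<noteq> 0"
  shows "pker r s \<le> 128 * (1 - r) / s\<^sup>2"
proof -
  have d: "s\<^sup>2 / 64 \<le> 1 - 2 * r * cos s + r\<^sup>2"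
  proof (cases "r < 1 / 2")
    case True
    have "s\<^sup>2 \<le> 4\<^sup>2"
      using s pi_less_4 by (intro power2_le_iff_abs_le[THEN iffD2]) auto
    then have "s\<^sup>2 / 64 \<le> (1 / 2)\<^sup>2" by (simp add: power2_eq_square)
    also have "\<dots> \<le> (1 - r)\<^sup>2" using True r by (intro power_mono) auto
    also have "\<dots> \<le> 1 - 2 * r * cos s + r\<^sup>2" using r by (intro pker_denom_ge)
    finally show ?thesis .
  next
    case False
    have "s\<^sup>2 / 64 \<le> s\<^sup>2 / 8" by simp
    also have "\<dots> \<le> 1 * (1 - cos s)" using one_minus_cos_ge[OF s(1)] by simp
    also have "\<dots> \<le> 2 * r * (1 - cos s)" using False by (intro mult_right_mono) auto
    also have "\<dots> \<le> 1 - 2 * r * cos s + r\<^sup>2" unfolding pker_denom by simp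
    finally show ?thesis .
  qed
  have "pker r s \<le> (1 - r\<^sup>2) / (s\<^sup>2 / 64)"
    unfolding pker_def using r s
    by (intro divide_left_mono d mult_pos_pos less_le_trans[OF _ d]) (auto simp: power_le_one)
  also have "1 - r\<^sup>2 \<le> 2 * (1 - r)"
    using zero_le_power2[of "1 - r"] by (simp add: power2_eq_square algebra_simps)
  then have "(1 - r\<^sup>2) / (s\<^sup>2 / 64) \<le> 2 * (1 - r) / (s\<^sup>2 / 64)"
    by (intro divide_right_mono) auto
  finally show ?thesis by simp
qed

text \<open>In this range both terms of the denominator are at most \<open>(1 - r)\<^sup>2\<close>,
  while the numerator is at least \<open>1 - r\<close>. The constant 4 is generous.\<close>

lemma pker_ge:
  assumes r: "0 \<le> r" "r < 1" and s: "\<bar>s\<bar> \<le> 1 - r"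
  shows "1 / (4 * (1 - r)) \<le> pker r s"
proof -
  have cos: "1 - cos s \<le> s\<^sup>2 / 2"
  proof -
    have "\<bar>sin (s / 2)\<bar> \<le> \<bar>s / 2\<bar>" by (rule abs_sin_x_le_abs_x)
    then have "(sin (s / 2))\<^sup>2 \<le> (s / 2)\<^sup>2" by (rule abs_le_square_iff[THEN iffD1])
    then show ?thesis
      using cos_double_sin[of "s / 2"] by (simp add: power_divide)
  qed
  have "2 * r * (1 - cos s) \<le> 2 * 1 * (s\<^sup>2 / 2)"
    using r cos by (intro mult_mono) auto
  moreover have "s\<^sup>2 \<le> (1 - r)\<^sup>2"
    using s power2_le_iff_abs_le[of "1 - r" s] r by auto
  ultimately have d: "1 - 2 * r * cos s + r\<^sup>2 \<le> 4 * (1 - r)\<^sup>2"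
    unfolding pker_denom using zero_le_power2[of "1 - r"] by linarith
  have pos: "0 < 1 - 2 * r * cos s + r\<^sup>2"
    using r by (intro less_le_trans[OF _ pker_denom_ge]) auto
  have "1 / (4 * (1 - r)) = (1 - r) / (4 * (1 - r)\<^sup>2)"
    using r by (simp add: power2_eq_square)
  also have "\<dots> \<le> (1 - r\<^sup>2) / (4 * (1 - r)\<^sup>2)"
    using r by (intro divide_right_mono) (auto simp: power2_eq_square mult_left_le)
  also have "\<dots> \<le> pker r s"
    unfolding pker_def using r d pos by (intro divide_left_mono) (auto simp: power_le_one)
  finally show ?thesis .
qed

section \<open>Dyadic scales around a point of the circle\<close>

lemma dyadic_scale:
  fixes h :: real
  assumes "0 < h" "h \<le> 1"
  obtains N :: nat where "pi / 2 ^ N \<le> h" "h < 2 * pi / 2 ^ N"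
proof -
  define N where "N = (LEAST n. pi / 2 ^ n \<le> h)"
  have "(\<lambda>n. pi * (1 / 2) ^ n) \<longlonglongrightarrow> pi * 0"
    by (intro tendsto_intros LIMSEQ_power_zero) auto
  then have "eventually (\<lambda>n. pi * (1 / 2) ^ n < h) sequentially"
    by (rule order_tendstoD) (use assms in simp)
  then obtain n where "pi / 2 ^ n \<le> h"
    by (auto simp: eventually_sequentially power_divide intro: less_imp_le)
  then have N: "pi / 2 ^ N \<le> h"
    unfolding N_def by (rule LeastI)
  \<comment> \<open>As \<open>h \<le> 1 < pi\<close>, the least index is positive, so its minimality
    can be tested one step earlier.\<close>
  then have "N \<noteq> 0" using assms pi_gt3 by (intro notI) simp
  then obtain M where M: "N = Suc M" using not0_implies_Suc by blast
  then have "\<not> pi / 2 ^ M \<le> h"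
    using not_less_Least[of M "\<lambda>n. pi / 2 ^ n \<le> h"] by (simp add: N_def)
  then show ?thesis
    using that[OF N] by (simp add: M)
qed

text \<open>Concentric arcs about the angle \<open>\<theta>\<close>, not pieces of the bisection
  tree above. \<open>dint \<theta> 0\<close> is a full period; with \<open>N\<close> from
  \<open>dyadic_scale\<close>, \<open>dint \<theta> N\<close> is the core arc belonging to
  \<open>z\<close>, of half-length comparable to \<open>1 - r\<close>.\<close>

definition dint :: "real \<Rightarrow> nat \<Rightarrow> real set" where
  "dint \<theta> k = {\<theta> - pi / 2 ^ k..<\<theta> + pi / 2 ^ k}"

lemma dint_sets [measurable]: "dint \<theta> k \<in> sets borel"
  by (simp add: dint_def)

lemma pi_pow_antimono: "i \<le> j \<Longrightarrow> pi / 2 ^ j \<le> pi / 2 ^ i"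
  by (intro divide_left_mono) auto

lemma dint_mono: "i \<le> j \<Longrightarrow> dint \<theta> j \<subseteq> dint \<theta> i"
  using pi_pow_antimono[of i j] by (auto simp: dint_def)

text \<open>One term dominates the kernel, that of the smallest of these arcs containing
  \<open>t\<close>; the others are nonnegative. The index \<open>j = N - k\<close> counts doublings
  of the core arc, and \<open>4 ^ j\<close> is the quadratic decay of the kernel.\<close>

lemma pker_le_dyadic_sum:
  assumes r: "0 \<le> r" "r < 1" and N: "pi / 2 ^ N \<le> 1 - r" "1 - r < 2 * pi / 2 ^ N"
    and t: "t \<in> dint \<theta> 0"
  shows "pker r (t - \<theta>) \<le> (\<Sum>j\<le>N. 1024 * 2 ^ N / 4 ^ j * indicator (dint \<theta> (N - j)) t)"
proof -
  define k where "k = (GREATEST k. k \<le> N \<and> t \<in> dint \<theta> k)"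
  have k: "k \<le> N \<and> t \<in> dint \<theta> k"
    unfolding k_def by (rule GreatestI_nat[where k=0 and b=N]) (use t in auto)
  have le: "pker r (t - \<theta>) \<le> 1024 * 2 ^ N / 4 ^ (N - k)"
  proof (cases "k = N")
    case True
    have "pker r (t - \<theta>) \<le> 2 / (1 - r)" using r by (rule pker_le)
    also have "\<dots> \<le> 2 / (pi / 2 ^ N)"
      using N r by (intro divide_left_mono) auto
    also have "\<dots> = (2 / pi) * 2 ^ N" by simp
    also have "\<dots> \<le> 1024 * 2 ^ N"
      using pi_gt3 by (intro mult_right_mono) (auto simp: field_simps)
    finally show ?thesis using True by simp
  next
    case False
    then have kN: "k < N" using k by simp
    have "t \<notin> dint \<theta> (Suc k)"
      using Greatest_le_nat[of "\<lambda>k. k \<le> N \<and> t \<in> dint \<theta> k" "Suc k" N] kN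
      unfolding k_def[symmetric] by auto
    moreover have "t \<in> dint \<theta> 0" by (rule t)
    ultimately have s: "pi / 2 ^ Suc k \<le> \<bar>t - \<theta>\<bar>" "\<bar>t - \<theta>\<bar> \<le> pi"
      by (auto simp: dint_def abs_if)
    have p: "0 < pi / 2 ^ Suc k" by simp
    have s0: "t - \<theta> \<noteq> 0" using s p by linarith
    have "(pi / 2 ^ Suc k)\<^sup>2 \<le> \<bar>t - \<theta>\<bar>\<^sup>2"
      using s(1) p by (intro power_mono) auto
    then have sq: "(pi / 2 ^ Suc k)\<^sup>2 \<le> (t - \<theta>)\<^sup>2" by simp
    have "pker r (t - \<theta>) \<le> 128 * (1 - r) / (t - \<theta>)\<^sup>2"
      by (rule pker_le_far[OF r s(2) s0])
    also have "\<dots> \<le> 128 * (1 - r) / (pi / 2 ^ Suc k)\<^sup>2"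
      using r s0 by (intro divide_left_mono sq) auto
    also have "\<dots> \<le> 128 * (2 * pi / 2 ^ N) / (pi / 2 ^ Suc k)\<^sup>2"
      using N by (intro divide_right_mono mult_left_mono) auto
    \<comment> \<open>Here \<open>1024 = 128 * 2 * 4\<close>, the 4 coming from the index
      \<open>Suc k\<close>; the factor \<open>1 / pi\<close> is dropped next.\<close>
    also have "\<dots> = 1024 * 4 ^ k / 2 ^ N / pi"
      by (simp add: power2_eq_square field_simps flip: power_mult_distrib)
    also have "\<dots> \<le> 1024 * 4 ^ k / 2 ^ N / 1"
      using pi_gt3 by (intro divide_left_mono) auto
    also have "\<dots> = 1024 * 2 ^ N / 4 ^ (N - k)"
      using k by (simp add: field_simps power_diff flip: power_mult_distrib)
    finally show ?thesis .
  qed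
  also have "\<dots> = 1024 * 2 ^ N / 4 ^ (N - k) * indicator (dint \<theta> (N - (N - k))) t"
    using k by simp
  also have "\<dots> \<le> (\<Sum>j\<le>N. 1024 * 2 ^ N / 4 ^ j * indicator (dint \<theta> (N - j)) t)"
    by (rule member_le_sum) auto
  finally show ?thesis .
qed

lemma nn_integral_pker_le:
  assumes r: "0 \<le> r" "r < 1" and N: "pi / 2 ^ N \<le> 1 - r" "1 - r < 2 * pi / 2 ^ N"
    and [measurable]: "g \<in> borel_measurable borel"
  shows "(\<integral>\<^sup>+ t\<in>dint \<theta> 0. g t * ennreal (pker r (t - \<theta>)) \<partial>lborel)
    \<le> (\<Sum>j\<le>N. ennreal (1024 * 2 ^ N / 4 ^ j) * (\<integral>\<^sup>+ t\<in>dint \<theta> (N - j). g t \<partial>lborel))"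
proof -
  have "(\<integral>\<^sup>+ t\<in>dint \<theta> 0. g t * ennreal (pker r (t - \<theta>)) \<partial>lborel)
      \<le> (\<integral>\<^sup>+ t. (\<Sum>j\<le>N. ennreal (1024 * 2 ^ N / 4 ^ j) * (g t * indicator (dint \<theta> (N - j)) t)) \<partial>lborel)"
  proof (rule nn_integral_mono)
    fix t
    show "g t * ennreal (pker r (t - \<theta>)) * indicator (dint \<theta> 0) t
      \<le> (\<Sum>j\<le>N. ennreal (1024 * 2 ^ N / 4 ^ j) * (g t * indicator (dint \<theta> (N - j)) t))"
    proof (cases "t \<in> dint \<theta> 0")
      case True
      have "g t * ennreal (pker r (t - \<theta>))
          \<le> g t * ennreal (\<Sum>j\<le>N. 1024 * 2 ^ N / 4 ^ j * indicator (dint \<theta> (N - j)) t)"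
        by (intro mult_left_mono ennreal_leI pker_le_dyadic_sum[OF r N True]) simp
      also have "\<dots> = g t * (\<Sum>j\<le>N. ennreal (1024 * 2 ^ N / 4 ^ j * indicator (dint \<theta> (N - j)) t))"
        by (rule arg_cong[where f="\<lambda>x. g t * x"], rule sum_ennreal[symmetric]) auto
      also have "\<dots> = g t * (\<Sum>j\<le>N. ennreal (1024 * 2 ^ N / 4 ^ j) * indicator (dint \<theta> (N - j)) t)"
        by (intro arg_cong[where f="\<lambda>x. g t * x"] sum.cong) (auto split: split_indicator)
      also have "\<dots> = (\<Sum>j\<le>N. ennreal (1024 * 2 ^ N / 4 ^ j) * (g t * indicator (dint \<theta> (N - j)) t))"
        unfolding sum_distrib_left by (simp only: ac_simps)
      finally show ?thesis using True by simp
    qed simp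
  qed
  also have "\<dots> = (\<Sum>j\<le>N. \<integral>\<^sup>+ t. ennreal (1024 * 2 ^ N / 4 ^ j) * (g t * indicator (dint \<theta> (N - j)) t) \<partial>lborel)"
    by (rule nn_integral_sum) measurable
  also have "\<dots> = (\<Sum>j\<le>N. ennreal (1024 * 2 ^ N / 4 ^ j) * (\<integral>\<^sup>+ t\<in>dint \<theta> (N - j). g t \<partial>lborel))"
    by (intro sum.cong nn_integral_cmult) auto
  finally show ?thesis .
qed

text \<open>This is the second formal derivative of the geometric series. Its quadratic factor
  dominates the squared drift of the means over \<open>j\<close> dyadic scales.\<close>

lemma summable_quadratic_geometric:
  fixes q :: real
  assumes "0 \<le> q" "q < 1"
  shows "summable (\<lambda>j. (real j + 1) * (real j + 2) * q ^ j)"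
proof -
  have 1: "summable (\<lambda>n. diffs (\<lambda>_. 1) n * x ^ n)" if "norm x < 1" for x :: real
    by (rule termdiff_converges[OF that]) (simp add: summable_geometric)
  have "summable (\<lambda>n. diffs (diffs (\<lambda>_. 1)) n * q ^ n)"
    by (rule termdiff_converges[of q 1]) (use assms 1 in auto)
  then show ?thesis
    by (simp add: diffs_def ac_simps)
qed

section \<open>Poisson averages of an A2 weight\<close>

context A2_line
begin

definition ratio :: real where "ratio = 1 - 1 / (4 * A)"

lemma ratio: "0 \<le> ratio" "ratio < 1"
  using A_ge_1 by (auto simp: ratio_def)

lemma mass_dint_Suc: "mass (dint \<theta> (Suc k)) \<le> ratio * mass (dint \<theta> k)"
  unfolding ratio_def dint_def
proof (rule mass_half_le)
  show "2 * measure lborel {\<theta> - pi / 2 ^ Suc k..<\<theta> + pi / 2 ^ Suc k} \<le> \<theta> + pi / 2 ^ k - (\<theta> - pi / 2 ^ k)"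
    by (simp add: field_simps)
  show "\<theta> + pi / 2 ^ k - (\<theta> - pi / 2 ^ k) \<le> 2 * pi"
    using pi_pow_antimono[of 0 k] by simp
  show "{\<theta> - pi / 2 ^ Suc k..<\<theta> + pi / 2 ^ Suc k} \<subseteq> {\<theta> - pi / 2 ^ k..<\<theta> + pi / 2 ^ k}"
    using dint_mono[of k "Suc k" \<theta>] by (simp add: dint_def)
qed (auto simp: add_strict_increasing)

lemma mass_dint_add: "mass (dint \<theta> (k + j)) \<le> ratio ^ j * mass (dint \<theta> k)"
proof (induction j)
  case (Suc j)
  have "mass (dint \<theta> (k + Suc j)) \<le> ratio * mass (dint \<theta> (k + j))"
    using mass_dint_Suc[of \<theta> "k + j"] by simp
  also have "\<dots> \<le> ratio * (ratio ^ j * mass (dint \<theta> k))"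
    using Suc ratio by (intro mult_left_mono) auto
  finally show ?case by simp
qed simp

lemma nn_integral_mass_dint: "(\<integral>\<^sup>+ t\<in>dint \<theta> k. ennreal (v t) \<partial>lborel) = ennreal (mass (dint \<theta> k))"
  by (rule nn_integral_mass[of _ "\<theta> - pi / 2 ^ k" "\<theta> + pi / 2 ^ k"]) (simp_all add: dint_def)

lemma mass_dint_pos: "0 < mass (dint \<theta> k)"
  unfolding dint_def by (rule mass_pos) (simp add: add_strict_increasing)

text \<open>The reverse doubling property of the dual weight beats the trivial doubling bound
  \<open>A * 4 ^ j\<close> by a geometric factor; this makes the sums over dyadic scales converge.\<close>

lemma mass_dint_growth:
  "mass (dint \<theta> k) \<le> A * (4 * ratio) ^ j * mass (dint \<theta> (k + j))"
proof -
  interpret D: A2_line "\<lambda>t. 1 / v t" A by (rule dual)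
  have len: "\<theta> + pi / 2 ^ i - (\<theta> - pi / 2 ^ i) = 2 * pi / 2 ^ i" for i :: nat
    by simp
  \<comment> \<open>The A2 condition bounds the product of the two masses above on the large arc,
    Cauchy--Schwarz bounds it below on the small one. Cancelling the dual mass leaves a comparison
    for \<open>v\<close>.\<close>
  have "mass (dint \<theta> k) * D.mass (dint \<theta> k) \<le> A * (2 * pi / 2 ^ k)\<^sup>2"
    using A2[of "\<theta> - pi / 2 ^ k" "\<theta> + pi / 2 ^ k"] pi_pow_antimono[of 0 k]
    unfolding mass_def D.mass_def dint_def len by (simp add: add_strict_increasing)
  also have "\<dots> = A * 4 ^ j * (2 * pi / 2 ^ (k + j))\<^sup>2"
    by (simp add: power2_eq_square power_add field_simps flip: power_mult_distrib)
  also have "\<dots> \<le> A * 4 ^ j * (mass (dint \<theta> (k + j)) * D.mass (dint \<theta> (k + j)))"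
    using length_square_le[of "\<theta> - pi / 2 ^ (k + j)" "\<theta> + pi / 2 ^ (k + j)"] A_ge_1
    unfolding D.mass_def dint_def len by (intro mult_left_mono) (auto simp: add_strict_increasing)
  also have "\<dots> \<le> A * 4 ^ j * (mass (dint \<theta> (k + j)) * (ratio ^ j * D.mass (dint \<theta> k)))"
    using D.mass_dint_add[of \<theta> k j] A_ge_1 mass_nonneg
    by (intro mult_left_mono) (auto simp: ratio_def D.ratio_def)
  finally have "mass (dint \<theta> k) * D.mass (dint \<theta> k)
      \<le> (A * (4 * ratio) ^ j * mass (dint \<theta> (k + j))) * D.mass (dint \<theta> k)"
    by (simp add: power_mult_distrib ac_simps)
  then show ?thesis
    by (rule mult_right_le_imp_le) (rule D.mass_dint_pos)
qed

text \<open>The factor 1024 comes from the kernel majorant, \<open>A\<close> from the growth of mass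
  over dilated arcs, and the series from the sum over scales.\<close>

definition poisson_const :: real where
  "poisson_const = 1024 * A * (\<Sum>j. (real j + 1) * (real j + 2) * ratio ^ j)"

lemma poisson_const_nonneg: "0 \<le> poisson_const"
  unfolding poisson_const_def using A_ge_1 ratio summable_quadratic_geometric[OF ratio]
  by (intro mult_nonneg_nonneg suminf_nonneg) auto

text \<open>The kernel decay \<open>4 ^ j\<close> cancels the same factor in the growth of mass, and
  \<open>ratio ^ j\<close> remains to be summed. That still tolerates quadratic growth in
  \<open>j\<close>; \<open>g\<close> will be \<open>v\<close> or \<open>v\<close> times a squared
  deviation.\<close>

lemma nn_integral_pker_mass_le:
  assumes r: "0 \<le> r" "r < 1" and N: "pi / 2 ^ N \<le> 1 - r" "1 - r < 2 * pi / 2 ^ N"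
    and [measurable]: "g \<in> borel_measurable borel" and \<alpha>: "0 \<le> \<alpha>"
    and g: "\<And>j. j \<le> N \<Longrightarrow> (\<integral>\<^sup>+ t\<in>dint \<theta> (N - j). g t \<partial>lborel)
      \<le> ennreal (\<alpha> * ((real j + 1) * (real j + 2)) * mass (dint \<theta> (N - j)))"
  shows "(\<integral>\<^sup>+ t\<in>dint \<theta> 0. g t * ennreal (pker r (t - \<theta>)) \<partial>lborel)
    \<le> ennreal (\<alpha> * poisson_const * 2 ^ N * mass (dint \<theta> N))"
proof -
  have bound: "1024 * 2 ^ N / 4 ^ j * (\<alpha> * ((real j + 1) * (real j + 2)) * mass (dint \<theta> (N - j)))
      \<le> 1024 * A * \<alpha> * 2 ^ N * mass (dint \<theta> N) * ((real j + 1) * (real j + 2) * ratio ^ j)"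
    if "j \<le> N" for j
  proof -
    have "1024 * 2 ^ N / 4 ^ j * (\<alpha> * ((real j + 1) * (real j + 2)) * mass (dint \<theta> (N - j)))
        \<le> 1024 * 2 ^ N / 4 ^ j * (\<alpha> * ((real j + 1) * (real j + 2))
            * (A * (4 * ratio) ^ j * mass (dint \<theta> N)))"
      using mass_dint_growth[of \<theta> "N - j" j] that \<alpha> by (intro mult_left_mono) auto
    also have "\<dots> = 1024 * A * \<alpha> * 2 ^ N * mass (dint \<theta> N) * ((real j + 1) * (real j + 2) * ratio ^ j)"
      by (simp add: power_mult_distrib)
    finally show ?thesis .
  qed
  have "(\<integral>\<^sup>+ t\<in>dint \<theta> 0. g t * ennreal (pker r (t - \<theta>)) \<partial>lborel)
      \<le> (\<Sum>j\<le>N. ennreal (1024 * 2 ^ N / 4 ^ j) * (\<integral>\<^sup>+ t\<in>dint \<theta> (N - j). g t \<partial>lborel))"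
    by (rule nn_integral_pker_le[OF r N]) simp
  also have "\<dots> \<le> (\<Sum>j\<le>N. ennreal (1024 * 2 ^ N / 4 ^ j)
      * ennreal (\<alpha> * ((real j + 1) * (real j + 2)) * mass (dint \<theta> (N - j))))"
    by (intro sum_mono mult_left_mono g) auto
  also have "\<dots> = (\<Sum>j\<le>N. ennreal (1024 * 2 ^ N / 4 ^ j
      * (\<alpha> * ((real j + 1) * (real j + 2)) * mass (dint \<theta> (N - j)))))"
    by (intro sum.cong refl ennreal_mult[symmetric]) (use \<alpha> mass_nonneg in auto)
  also have "\<dots> = ennreal (\<Sum>j\<le>N. 1024 * 2 ^ N / 4 ^ j
      * (\<alpha> * ((real j + 1) * (real j + 2)) * mass (dint \<theta> (N - j))))"
    by (intro sum_ennreal) (use \<alpha> mass_nonneg in auto)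
  also have "\<dots> \<le> ennreal (\<alpha> * poisson_const * 2 ^ N * mass (dint \<theta> N))"
  proof (rule ennreal_leI)
    have "(\<Sum>j\<le>N. 1024 * 2 ^ N / 4 ^ j * (\<alpha> * ((real j + 1) * (real j + 2)) * mass (dint \<theta> (N - j))))
        \<le> 1024 * A * \<alpha> * 2 ^ N * mass (dint \<theta> N) * (\<Sum>j\<le>N. (real j + 1) * (real j + 2) * ratio ^ j)"
      unfolding sum_distrib_left by (intro sum_mono bound) auto
    also have "\<dots> \<le> 1024 * A * \<alpha> * 2 ^ N * mass (dint \<theta> N)
        * (\<Sum>j. (real j + 1) * (real j + 2) * ratio ^ j)"
      using A_ge_1 \<alpha> mass_nonneg ratio
      by (intro mult_left_mono sum_le_suminf summable_quadratic_geometric) auto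
    also have "\<dots> = \<alpha> * poisson_const * 2 ^ N * mass (dint \<theta> N)"
      by (simp add: poisson_const_def)
    finally show "(\<Sum>j\<le>N. 1024 * 2 ^ N / 4 ^ j * (\<alpha> * ((real j + 1) * (real j + 2)) * mass (dint \<theta> (N - j))))
        \<le> \<alpha> * poisson_const * 2 ^ N * mass (dint \<theta> N)" .
  qed
  finally show ?thesis .
qed

lemma nn_integral_pker_le_mass:
  assumes r: "0 \<le> r" "r < 1" and N: "pi / 2 ^ N \<le> 1 - r" "1 - r < 2 * pi / 2 ^ N"
  shows "(\<integral>\<^sup>+ t\<in>dint \<theta> 0. ennreal (v t) * ennreal (pker r (t - \<theta>)) \<partial>lborel)
    \<le> ennreal (poisson_const * 2 ^ N * mass (dint \<theta> N))"
proof -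
  have "(\<integral>\<^sup>+ t\<in>dint \<theta> (N - j). ennreal (v t) \<partial>lborel)
      \<le> ennreal (1 * ((real j + 1) * (real j + 2)) * mass (dint \<theta> (N - j)))" for j
  proof -
    have "1 * mass (dint \<theta> (N - j)) \<le> 1 * ((real j + 1) * (real j + 2)) * mass (dint \<theta> (N - j))"
      by (intro mult_right_mono mass_nonneg) (simp add: algebra_simps)
    then show ?thesis
      unfolding nn_integral_mass_dint by (intro ennreal_leI) simp
  qed
  from nn_integral_pker_mass_le[OF r N _ _ this] show ?thesis by simp
qed

text \<open>With the preceding upper bound, the Poisson integral of \<open>v\<close> is comparable
  to \<open>2 ^ N\<close> times the mass of the core arc. Everything outside the core is discarded;
  on it the kernel is at least \<open>2 ^ N / (8 * pi)\<close>.\<close>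

lemma nn_integral_pker_ge_mass:
  assumes r: "0 \<le> r" "r < 1" and N: "pi / 2 ^ N \<le> 1 - r" "1 - r < 2 * pi / 2 ^ N"
  shows "ennreal (2 ^ N / (8 * pi) * mass (dint \<theta> N))
    \<le> (\<integral>\<^sup>+ t\<in>dint \<theta> 0. ennreal (v t) * ennreal (pker r (t - \<theta>)) \<partial>lborel)"
proof -
  have "ennreal (2 ^ N / (8 * pi) * mass (dint \<theta> N))
      = ennreal (2 ^ N / (8 * pi)) * (\<integral>\<^sup>+ t\<in>dint \<theta> N. ennreal (v t) \<partial>lborel)"
    unfolding nn_integral_mass_dint by (rule ennreal_mult) (auto simp: mass_nonneg)
  also have "\<dots> = (\<integral>\<^sup>+ t. ennreal (2 ^ N / (8 * pi)) * (ennreal (v t) * indicator (dint \<theta> N) t) \<partial>lborel)"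
    by (rule nn_integral_cmult[symmetric]) measurable
  also have "\<dots> \<le> (\<integral>\<^sup>+ t\<in>dint \<theta> 0. ennreal (v t) * ennreal (pker r (t - \<theta>)) \<partial>lborel)"
  proof (rule nn_integral_mono)
    fix t
    show "ennreal (2 ^ N / (8 * pi)) * (ennreal (v t) * indicator (dint \<theta> N) t)
      \<le> ennreal (v t) * ennreal (pker r (t - \<theta>)) * indicator (dint \<theta> 0) t"
    proof (cases "t \<in> dint \<theta> N")
      case True
      then have "t \<in> dint \<theta> 0" using dint_mono[of 0 N] by auto
      have "2 ^ N / (8 * pi) = 1 / (4 * (2 * pi / 2 ^ N))" by simp
      also have "\<dots> \<le> 1 / (4 * (1 - r))"
        using N r by (intro divide_left_mono) auto
      also have "\<dots> \<le> pker r (t - \<theta>)"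
        using True N by (intro pker_ge r) (auto simp: dint_def)
      finally show ?thesis
        using True \<open>t \<in> dint \<theta> 0\<close> by (simp add: mult.commute mult_left_mono ennreal_leI)
    qed simp
  qed
  finally show ?thesis .
qed

end

section \<open>Integrals of periodic functions over a full period\<close>

lemma nn_integral_periodic_translate:
  fixes g :: "real \<Rightarrow> ennreal"
  assumes [measurable]: "g \<in> borel_measurable borel" and per: "\<And>t. g (t + 2 * pi) = g t"
  shows "(\<integral>\<^sup>+ t\<in>{a + of_int m * (2 * pi)..<b + of_int m * (2 * pi)}. g t \<partial>lborel)
    = (\<integral>\<^sup>+ t\<in>{a..<b}. g t \<partial>lborel)"
proof -
  interpret periodic_fun_simple g "2 * pi" by standard (rule per)
  let ?p = "of_int m * (2 * pi)"
  have "(\<integral>\<^sup>+ t\<in>{a + ?p..<b + ?p}. g t \<partial>lborel)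
      = (\<integral>\<^sup>+ t. g (?p + 1 * t) * indicator {a + ?p..<b + ?p} (?p + 1 * t) \<partial>lborel)"
    by (subst nn_integral_real_affine[where c=1 and t="?p"]) auto
  also have "\<dots> = (\<integral>\<^sup>+ t\<in>{a..<b}. g t \<partial>lborel)"
    using plus_of_int[of _ m] by (intro nn_integral_cong) (auto simp: add.commute split: split_indicator)
  finally show ?thesis .
qed

lemma nn_integral_atLeastLessThan_Icc:
  "(\<integral>\<^sup>+ t\<in>{a..<b}. g t \<partial>lborel) = (\<integral>\<^sup>+ t\<in>{a..b::real}. g t \<partial>lborel)"
proof (rule nn_integral_null_delta)
  have "{a..<b} - {a..b} \<union> ({a..b} - {a..<b}) \<subseteq> {b}" by auto
  then show "{a..<b} - {a..b} \<union> ({a..b} - {a..<b}) \<in> null_sets lborel"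
    by (rule null_sets_subset[rotated 2]) auto
qed auto

lemma nn_integral_periodic:
  fixes g :: "real \<Rightarrow> ennreal"
  assumes [measurable]: "g \<in> borel_measurable borel" and per: "\<And>t. g (t + 2 * pi) = g t"
  shows "(\<integral>\<^sup>+ t\<in>{a..<a + 2 * pi}. g t \<partial>lborel) = (\<integral>\<^sup>+ t\<in>{0..2 * pi}. g t \<partial>lborel)"
proof -
  \<comment> \<open>This gives the first multiple of \<open>2 * pi\<close> at or after
    \<open>a\<close>; the part of the interval before it is moved forward by one period.\<close>
  define m where "m = \<lceil>a / (2 * pi)\<rceil>"
  let ?p = "of_int m * (2 * pi)"
  have "a / (2 * pi) \<le> of_int m" "of_int m < a / (2 * pi) + 1"
    unfolding m_def by linarith+
  then have p: "a \<le> ?p" "?p \<le> a + 2 * pi"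
    by (auto simp: field_simps)
  have "(\<integral>\<^sup>+ t\<in>{a..<a + 2 * pi}. g t \<partial>lborel)
      = (\<integral>\<^sup>+ t\<in>{a..<?p}. g t \<partial>lborel) + (\<integral>\<^sup>+ t\<in>{?p..<a + 2 * pi}. g t \<partial>lborel)"
    using p by (intro nn_integral_split) auto
  also have "(\<integral>\<^sup>+ t\<in>{a..<?p}. g t \<partial>lborel) = (\<integral>\<^sup>+ t\<in>{a + 2 * pi..<?p + 2 * pi}. g t \<partial>lborel)"
    using nn_integral_periodic_translate[OF assms, where m=1 and a=a and b="?p"] by simp
  also have "\<dots> + (\<integral>\<^sup>+ t\<in>{?p..<a + 2 * pi}. g t \<partial>lborel) = (\<integral>\<^sup>+ t\<in>{?p..<?p + 2 * pi}. g t \<partial>lborel)"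
    using p by (subst add.commute, intro nn_integral_split[symmetric]) auto
  also have "\<dots> = (\<integral>\<^sup>+ t\<in>{0..<2 * pi}. g t \<partial>lborel)"
    using nn_integral_periodic_translate[OF assms, where m=m and a=0 and b="2 * pi"] by (simp add: add.commute)
  finally show ?thesis
    by (simp add: nn_integral_atLeastLessThan_Icc)
qed

lemma nn_integral_dint_0:
  fixes g :: "real \<Rightarrow> ennreal"
  assumes "g \<in> borel_measurable borel" "\<And>t. g (t + 2 * pi) = g t"
  shows "(\<integral>\<^sup>+ t\<in>dint \<theta> 0. g t \<partial>lborel) = (\<integral>\<^sup>+ t\<in>{0..2 * pi}. g t \<partial>lborel)"
  using nn_integral_periodic[OF assms, of "\<theta> - pi"] by (simp add: dint_def add.commute)

lemma nn_integral_pker: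
  assumes r: "0 \<le> r" "r < 1"
  shows "(\<integral>\<^sup>+ t\<in>{0..2 * pi}. ennreal (pker r (t - \<theta>)) \<partial>lborel) = ennreal (2 * pi)"
proof -
  \<comment> \<open>The arctan is minus the argument of \<open>1 - r * cis (t - \<theta>)\<close>, a
    number with positive real part, so \<open>F\<close> is smooth. This term is periodic, and only
    the summand \<open>t\<close> contributes to the increment.\<close>
  define F where "F t = t + 2 * arctan (r * sin (t - \<theta>) / (1 - r * cos (t - \<theta>)))" for t
  have "(\<integral>\<^sup>+ t\<in>{0..2 * pi}. ennreal (pker r (t - \<theta>)) \<partial>lborel) = ennreal (F (2 * pi) - F 0)"
  proof (rule nn_integral_FTC_Icc)
    fix t
    define c s where "c = cos (t - \<theta>)" and "s = sin (t - \<theta>)"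
    have cs: "s * s = 1 - c * c"
      using sin_squared_eq[of "t - \<theta>"] by (simp add: c_def s_def power2_eq_square)
    have "r * c \<le> r * 1" unfolding c_def using r by (intro mult_left_mono) auto
    then have pos: "0 < 1 - r * c" using r by simp
    have D: "0 < 1 - 2 * r * c + r\<^sup>2"
      unfolding c_def using r by (intro less_le_trans[OF _ pker_denom_ge]) auto
    have nz: "1 + (r * s / (1 - r * c))\<^sup>2 = (1 - 2 * r * c + r\<^sup>2) / (1 - r * c)\<^sup>2"
    proof -
      have "(1 - r * c)\<^sup>2 + r * r * (s * s) = 1 - 2 * r * c + r\<^sup>2"
        unfolding cs by (simp add: power2_eq_square algebra_simps)
      from this[symmetric] show ?thesis
        using pos by (simp add: add_divide_distrib power_divide power_mult_distrib power2_eq_square)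
    qed
    have "((\<lambda>t. r * sin (t - \<theta>) / (1 - r * cos (t - \<theta>))) has_real_derivative
        ((r * c) * (1 - r * c) - r * s * (r * s)) / ((1 - r * c) * (1 - r * c))) (at t)"
      using pos by (auto intro!: derivative_eq_intros simp: c_def s_def)
    from DERIV_add[OF DERIV_ident DERIV_cmult[OF DERIV_chain2[OF DERIV_arctan this], of 2]]
    have "(F has_real_derivative
        1 + 2 * (((r * c) * (1 - r * c) - r * s * (r * s)) / ((1 - r * c) * (1 - r * c))
          / (1 + (r * s / (1 - r * c))\<^sup>2))) (at t)"
      unfolding F_def[abs_def] by (simp add: c_def s_def divide_inverse ac_simps)
    also have "1 + 2 * (((r * c) * (1 - r * c) - r * s * (r * s)) / ((1 - r * c) * (1 - r * c))
          / (1 + (r * s / (1 - r * c))\<^sup>2)) = pker r (t - \<theta>)"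
    proof -
      have "(r * c) * (1 - r * c) - r * s * (r * s) = r * c - r * r * (c * c + s * s)"
        by (simp add: algebra_simps)
      also have "\<dots> = r * c - r * r" by (simp add: cs)
      finally have n: "(r * c) * (1 - r * c) - r * s * (r * s) = r * c - r * r" .
      have e: "x / (q * q) / (D / q\<^sup>2) = x / D" if "q > 0" for x q D :: real
        using that by (simp add: power2_eq_square)
      show ?thesis
        unfolding nz n e[OF pos] pker_def c_def[symmetric] using D
        by (simp add: field_simps power2_eq_square)
    qed
    finally show "(F has_real_derivative pker r (t - \<theta>)) (at t)" .
    show "0 \<le> pker r (t - \<theta>)" using r by (rule pker_nonneg)
  qed (use pi_ge_zero in auto)
  also have "F (2 * pi) - F 0 = 2 * pi"
    by (simp add: F_def sin_diff cos_diff)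
  finally show ?thesis .
qed

section \<open>Garsia norms and mean oscillation\<close>

definition osc_le :: "(real \<Rightarrow> complex) \<Rightarrow> real \<Rightarrow> bool" where
  "osc_le f B \<longleftrightarrow> (\<forall>a b. a < b \<longrightarrow> b - a \<le> 2 * pi \<longrightarrow>
     (LINT t:{a..<b}|lborel. norm (f t - avg f a b)) \<le> B * (b - a))"

text \<open>Each halving moves the mean by at most \<open>2 * B\<close>, because the oscillation is
  measured on an arc of twice the length. Telescoping gives growth linear in
  \<open>j\<close>.\<close>

lemma avg_dint_diff_le:
  assumes f: "loc_integrable f" and osc: "osc_le f B"
  shows "norm (avg f (\<theta> - pi / 2 ^ (k + j)) (\<theta> + pi / 2 ^ (k + j)) - avg f (\<theta> - pi / 2 ^ k) (\<theta> + pi / 2 ^ k))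
    \<le> 2 * B * real j"
proof (induction j)
  case (Suc j)
  define c where "c i = avg f (\<theta> - pi / 2 ^ i) (\<theta> + pi / 2 ^ i)" for i
  define i where "i = k + j"
  let ?J = "\<lambda>i. {\<theta> - pi / 2 ^ i..<\<theta> + pi / 2 ^ i}"
  have ab: "\<theta> - pi / 2 ^ n < \<theta> + pi / 2 ^ n" for n
    by (simp add: add_strict_increasing)
  have nf: "loc_integrable (\<lambda>t. norm (f t - c i))"
    using f by (intro loc_integrable_norm loc_integrable_diff) auto
  have sub: "?J (Suc i) \<subseteq> ?J i"
    using dint_mono[of i "Suc i" \<theta>] by (simp add: dint_def)
  have "norm (c (Suc i) - c i) * (2 * pi / 2 ^ Suc i) \<le> (LINT t:?J (Suc i)|lborel. norm (f t - c i))"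
    using norm_avg_minus_le[OF ab f, of "Suc i" "c i"] by (simp add: c_def)
  also have "\<dots> \<le> (LINT t:?J i|lborel. norm (f t - c i))"
    using sub loc_integrableD[OF nf]
    unfolding set_lebesgue_integral_def set_integrable_def
    by (intro integral_mono) (auto split: split_indicator)
  also have "\<dots> \<le> B * (2 * pi / 2 ^ i)"
    using osc[unfolded osc_le_def, rule_format, OF ab[of i]] pi_pow_antimono[of 0 i] by (simp add: c_def)
  also have "\<dots> = 2 * B * (2 * pi / 2 ^ Suc i)" by simp
  finally have "norm (c (Suc i) - c i) \<le> 2 * B"
    by (rule mult_right_le_imp_le) simp
  moreover have "norm (c i - c k) \<le> 2 * B * real j"
    using Suc by (simp add: c_def i_def)
  ultimately have "norm (c (Suc i) - c k) \<le> 2 * B + 2 * B * real j"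
    by (rule norm_diff_triangle_le)
  then show ?case
    by (simp add: c_def i_def algebra_simps)
qed simp

lemma norm_diff_square_le:
  fixes x y z :: complex
  shows "(norm (x - z))\<^sup>2 \<le> 2 * (norm (x - y))\<^sup>2 + 2 * (norm (y - z))\<^sup>2"
proof -
  have "norm (x - z) \<le> norm (x - y) + norm (y - z)"
    by (rule norm_diff_triangle_le) auto
  then have "(norm (x - z))\<^sup>2 \<le> (norm (x - y) + norm (y - z))\<^sup>2"
    by (intro power_mono) auto
  also have "\<dots> \<le> 2 * (norm (x - y))\<^sup>2 + 2 * (norm (y - z))\<^sup>2"
    using zero_le_power2[of "norm (x - y) - norm (y - z)"]
    by (simp add: power2_eq_square algebra_simps)
  finally show ?thesis .
qed

context A2_line
begin

text \<open>Recentring from \<open>c\<close> to \<open>d\<close>, with \<open>u\<close> either 1 on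
  an arc or the Poisson kernel. Unlike in \<open>leaf_sum_shift\<close>, nothing is absorbed
  afterwards, so the factor 2 is affordable.\<close>

lemma nn_integral_square_shift:
  fixes f :: "real \<Rightarrow> complex"
  assumes [measurable]: "f \<in> borel_measurable borel" "u \<in> borel_measurable borel" "E \<in> sets borel"
  shows "(\<integral>\<^sup>+ t\<in>E. ennreal ((norm (f t - c))\<^sup>2 * v t) * u t \<partial>lborel)
    \<le> 2 * (\<integral>\<^sup>+ t\<in>E. ennreal ((norm (f t - d))\<^sup>2 * v t) * u t \<partial>lborel)
      + ennreal (2 * (norm (d - c))\<^sup>2) * (\<integral>\<^sup>+ t\<in>E. ennreal (v t) * u t \<partial>lborel)"
proof -
  have "(\<integral>\<^sup>+ t\<in>E. ennreal ((norm (f t - c))\<^sup>2 * v t) * u t \<partial>lborel)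
      \<le> (\<integral>\<^sup>+ t. 2 * (ennreal ((norm (f t - d))\<^sup>2 * v t) * u t * indicator E t)
        + ennreal (2 * (norm (d - c))\<^sup>2) * (ennreal (v t) * u t * indicator E t) \<partial>lborel)"
  proof (rule nn_integral_mono)
    fix t
    have "(norm (f t - c))\<^sup>2 * v t \<le> 2 * ((norm (f t - d))\<^sup>2 * v t) + 2 * (norm (d - c))\<^sup>2 * v t"
      using mult_right_mono[OF norm_diff_square_le[of "f t" c d] nonneg[of t]] by (simp add: algebra_simps)
    then have "ennreal ((norm (f t - c))\<^sup>2 * v t)
        \<le> ennreal (2 * ((norm (f t - d))\<^sup>2 * v t) + 2 * (norm (d - c))\<^sup>2 * v t)"
      by (rule ennreal_leI)
    also have "\<dots> = ennreal 2 * ennreal ((norm (f t - d))\<^sup>2 * v t) + ennreal (2 * (norm (d - c))\<^sup>2) * ennreal (v t)"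
      using nonneg[of t] by (subst ennreal_plus) (auto simp only: ennreal_mult mult_nonneg_nonneg zero_le_power2 zero_le_numeral)
    finally have "ennreal ((norm (f t - c))\<^sup>2 * v t)
        \<le> 2 * ennreal ((norm (f t - d))\<^sup>2 * v t) + ennreal (2 * (norm (d - c))\<^sup>2) * ennreal (v t)"
      by simp
    from mult_right_mono[OF this, of "u t * indicator E t"]
    show "ennreal ((norm (f t - c))\<^sup>2 * v t) * u t * indicator E t
      \<le> 2 * (ennreal ((norm (f t - d))\<^sup>2 * v t) * u t * indicator E t)
        + ennreal (2 * (norm (d - c))\<^sup>2) * (ennreal (v t) * u t * indicator E t)"
      by (simp add: distrib_right mult.assoc)
  qed
  also have "\<dots> = 2 * (\<integral>\<^sup>+ t\<in>E. ennreal ((norm (f t - d))\<^sup>2 * v t) * u t \<partial>lborel)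
      + ennreal (2 * (norm (d - c))\<^sup>2) * (\<integral>\<^sup>+ t\<in>E. ennreal (v t) * u t \<partial>lborel)"
    by (simp add: nn_integral_add nn_integral_cmult)
  finally show ?thesis .
qed

text \<open>\<open>2 * JN_const + 8\<close> stems from recentring between means at distance
  \<open>2 * B * j\<close>, and \<open>8 * pi\<close> from bounding the Poisson integral of the
  weight below by the mass of the core arc.\<close>

definition garsia_const :: real where
  "garsia_const = (2 * JN_const + 8) * poisson_const * (8 * pi)"

lemma garsia_const_nonneg: "0 \<le> garsia_const"
  using JN_const_nonneg poisson_const_nonneg by (simp add: garsia_const_def)

text \<open>The centre is the mean over the core arc, not yet the Poisson average. On the
  \<open>j\<close>-th dilate the John--Nirenberg inequality is used around the dilate's own mean,
  and the shift to \<open>c\<close> costs a multiple of \<open>j\<^sup>2\<close>, which the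
  geometric factor absorbs.\<close>

lemma garsia_integral_avg_le:
  assumes f: "loc_integrable f" and [measurable]: "f \<in> borel_measurable borel" and B: "B > 0" and osc: "osc_le f B"
    and r: "0 \<le> r" "r < 1" and N: "pi / 2 ^ N \<le> 1 - r" "1 - r < 2 * pi / 2 ^ N"
    and c: "c = avg f (\<theta> - pi / 2 ^ N) (\<theta> + pi / 2 ^ N)"
  shows "(\<integral>\<^sup>+ t\<in>dint \<theta> 0. ennreal ((norm (f t - c))\<^sup>2 * v t) * ennreal (pker r (t - \<theta>)) \<partial>lborel)
    \<le> ennreal (garsia_const * B\<^sup>2) * (\<integral>\<^sup>+ t\<in>dint \<theta> 0. ennreal (v t) * ennreal (pker r (t - \<theta>)) \<partial>lborel)"
proof -
  have loc: "(\<integral>\<^sup>+ t\<in>dint \<theta> (N - j). ennreal ((norm (f t - c))\<^sup>2 * v t) \<partial>lborel)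
      \<le> ennreal ((2 * JN_const + 8) * B\<^sup>2 * ((real j + 1) * (real j + 2)) * mass (dint \<theta> (N - j)))"
    if j: "j \<le> N" for j
  proof -
    define k where "k = N - j"
    define d where "d = avg f (\<theta> - pi / 2 ^ k) (\<theta> + pi / 2 ^ k)"
    have N': "N = k + j" using j by (simp add: k_def)
    have "norm (c - d) \<le> 2 * B * real j"
      unfolding c d_def N' by (rule avg_dint_diff_le[OF f osc])
    then have dc: "(norm (d - c))\<^sup>2 \<le> (2 * B * real j)\<^sup>2"
      by (intro power_mono) (auto simp: norm_minus_commute)
    have jn: "(\<integral>\<^sup>+ t\<in>dint \<theta> k. ennreal ((norm (f t - d))\<^sup>2 * v t) \<partial>lborel)
        \<le> ennreal (JN_const * B\<^sup>2 * mass (dint \<theta> k))"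
      unfolding d_def dint_def
      by (rule weighted_john_nirenberg[OF f _ B])
        (use osc pi_pow_antimono[of 0 k] in \<open>auto simp: osc_le_def add_strict_increasing\<close>)
    have "(\<integral>\<^sup>+ t\<in>dint \<theta> k. ennreal ((norm (f t - c))\<^sup>2 * v t) \<partial>lborel)
        \<le> 2 * (\<integral>\<^sup>+ t\<in>dint \<theta> k. ennreal ((norm (f t - d))\<^sup>2 * v t) \<partial>lborel)
          + ennreal (2 * (norm (d - c))\<^sup>2) * (\<integral>\<^sup>+ t\<in>dint \<theta> k. ennreal (v t) \<partial>lborel)"
      using nn_integral_square_shift[of f "\<lambda>_. 1" "dint \<theta> k" c d] by simp
    also have "\<dots> \<le> 2 * ennreal (JN_const * B\<^sup>2 * mass (dint \<theta> k))
          + ennreal (2 * (2 * B * real j)\<^sup>2) * ennreal (mass (dint \<theta> k))"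
      unfolding nn_integral_mass_dint
      by (intro add_mono mult_left_mono mult_right_mono jn ennreal_leI dc) auto
    also have "\<dots> = ennreal (2 * (JN_const * B\<^sup>2 * mass (dint \<theta> k)) + 2 * (2 * B * real j)\<^sup>2 * mass (dint \<theta> k))"
      using mass_nonneg JN_const_nonneg by (simp add: ennreal_mult ennreal_plus)
    also have "\<dots> \<le> ennreal ((2 * JN_const + 8) * B\<^sup>2 * ((real j + 1) * (real j + 2)) * mass (dint \<theta> k))"
    proof (rule ennreal_leI)
      have "2 * JN_const * 1 + 8 * (real j)\<^sup>2 \<le> 2 * JN_const * ((real j + 1) * (real j + 2))
          + 8 * ((real j + 1) * (real j + 2))"
        using JN_const_nonneg by (intro add_mono mult_left_mono) (auto simp: algebra_simps power2_eq_square)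
      then have "(2 * JN_const + 8 * (real j)\<^sup>2) * (B\<^sup>2 * mass (dint \<theta> k))
          \<le> ((2 * JN_const + 8) * ((real j + 1) * (real j + 2))) * (B\<^sup>2 * mass (dint \<theta> k))"
        using mass_nonneg by (intro mult_right_mono) (auto simp: algebra_simps)
      then show "2 * (JN_const * B\<^sup>2 * mass (dint \<theta> k)) + 2 * (2 * B * real j)\<^sup>2 * mass (dint \<theta> k)
          \<le> (2 * JN_const + 8) * B\<^sup>2 * ((real j + 1) * (real j + 2)) * mass (dint \<theta> k)"
        by (simp add: power_mult_distrib algebra_simps)
    qed
    finally show ?thesis by (simp add: k_def)
  qed
  have "(\<integral>\<^sup>+ t\<in>dint \<theta> 0. ennreal ((norm (f t - c))\<^sup>2 * v t) * ennreal (pker r (t - \<theta>)) \<partial>lborel)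
      \<le> ennreal ((2 * JN_const + 8) * B\<^sup>2 * poisson_const * 2 ^ N * mass (dint \<theta> N))"
    by (rule nn_integral_pker_mass_le[OF r N _ _ loc]) (use JN_const_nonneg in auto)
  also have "\<dots> = ennreal (garsia_const * B\<^sup>2) * ennreal (2 ^ N / (8 * pi) * mass (dint \<theta> N))"
  proof -
    have "J * B\<^sup>2 * x * 2 ^ N * y = J * x * (8 * pi) * B\<^sup>2 * (2 ^ N / (8 * pi) * y)" for J x y :: real
      by simp
    from this[of "2 * JN_const + 8" poisson_const "mass (dint \<theta> N)", folded garsia_const_def]
    show ?thesis
      using garsia_const_nonneg mass_nonneg by (simp only:) (rule ennreal_mult, auto)
  qed
  also have "\<dots> \<le> ennreal (garsia_const * B\<^sup>2)
      * (\<integral>\<^sup>+ t\<in>dint \<theta> 0. ennreal (v t) * ennreal (pker r (t - \<theta>)) \<partial>lborel)"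
    by (intro mult_left_mono nn_integral_pker_ge_mass[OF r N]) auto
  finally show ?thesis .
qed

text \<open>The root comes from Cauchy--Schwarz and \<open>A\<close> from the A2 condition;
  \<open>8 * pi * pi\<close> combines the lower kernel bound with rounding to a dyadic scale, and
  the outer 2 replaces an arbitrary centre by the mean.\<close>

definition osc_const :: real where
  "osc_const = 2 * sqrt (8 * pi * pi * poisson_const * A)"

lemma osc_const_nonneg: "0 \<le> osc_const"
  using poisson_const_nonneg A_ge_1 by (simp add: osc_const_def)

lemma osc_le_of_garsia:
  assumes f: "loc_integrable f" and [measurable]: "f \<in> borel_measurable borel" and G: "0 \<le> G"
    and garsia: "\<And>r \<theta>. 0 \<le> r \<Longrightarrow> r < 1 \<Longrightarrow> \<exists>c.
      (\<integral>\<^sup>+ t\<in>dint \<theta> 0. ennreal ((norm (f t - c))\<^sup>2 * v t) * ennreal (pker r (t - \<theta>)) \<partial>lborel)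
      \<le> ennreal (G\<^sup>2) * (\<integral>\<^sup>+ t\<in>dint \<theta> 0. ennreal (v t) * ennreal (pker r (t - \<theta>)) \<partial>lborel)"
  shows "osc_le f (osc_const * G)"
  unfolding osc_le_def
proof (intro allI impI)
  fix a b :: real assume ab: "a < b" "b - a \<le> 2 * pi"
  \<comment> \<open>The point tested has angle \<open>\<theta>\<close> and distance \<open>h\<close>
    to the circle. Half-lengths reach pi, but the distance is at most 1: arcs with
    \<open>l > 1\<close> are tested at the origin, where the kernel is 1.\<close>
  define l \<theta> h where "l = (b - a) / 2" and "\<theta> = (a + b) / 2" and "h = min l 1"
  have l: "0 < l" "l \<le> pi" and h: "0 < h" "h \<le> 1" "h \<le> l"
    using ab by (auto simp: l_def h_def min_def)
  have ends: "a = \<theta> - l" "b = \<theta> + l" by (auto simp: l_def \<theta>_def field_simps)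
  have lh: "l \<le> pi * h"
    using l pi_gt3 by (auto simp: h_def min_def)
  define r where "r = 1 - h"
  have r: "0 \<le> r" "r < 1" "1 - r = h" using h by (auto simp: r_def)
  obtain N where N: "pi / 2 ^ N \<le> 1 - r" "1 - r < 2 * pi / 2 ^ N"
    using dyadic_scale[of h] h r by auto
  obtain c where c: "(\<integral>\<^sup>+ t\<in>dint \<theta> 0. ennreal ((norm (f t - c))\<^sup>2 * v t) * ennreal (pker r (t - \<theta>)) \<partial>lborel)
      \<le> ennreal (G\<^sup>2) * (\<integral>\<^sup>+ t\<in>dint \<theta> 0. ennreal (v t) * ennreal (pker r (t - \<theta>)) \<partial>lborel)"
    using garsia[OF r(1,2)] by blast
  have ker: "1 / (4 * l) \<le> pker r (t - \<theta>)" if "t \<in> {a..<b}" for t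
  proof (cases "l \<le> 1")
    case True
    then show ?thesis
      using pker_ge[OF r(1,2), of "t - \<theta>"] that r(3) by (auto simp: h_def ends)
  next
    case False
    then have "r = 0" by (simp add: r_def h_def)
    then show ?thesis using False by (simp add: pker_def field_simps)
  qed
  have sub: "{a..<b} \<subseteq> dint \<theta> 0"
    using l by (auto simp: ends dint_def)
  define C where "C = 8 * pi * pi * poisson_const * G\<^sup>2"
  have C0: "0 \<le> C" using poisson_const_nonneg by (simp add: C_def)
  have "(\<integral>\<^sup>+ t\<in>{a..<b}. ennreal ((norm (f t - c))\<^sup>2 * v t) \<partial>lborel)
      \<le> (\<integral>\<^sup>+ t. ennreal (4 * l) * (ennreal ((norm (f t - c))\<^sup>2 * v t) * ennreal (pker r (t - \<theta>)) * indicator (dint \<theta> 0) t) \<partial>lborel)"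
  proof (rule nn_integral_mono)
    fix t
    show "ennreal ((norm (f t - c))\<^sup>2 * v t) * indicator {a..<b} t
      \<le> ennreal (4 * l) * (ennreal ((norm (f t - c))\<^sup>2 * v t) * ennreal (pker r (t - \<theta>)) * indicator (dint \<theta> 0) t)"
    proof (cases "t \<in> {a..<b}")
      case True
      have "1 \<le> 4 * l * pker r (t - \<theta>)"
        using ker[OF True] l by (simp add: field_simps)
      then have "ennreal ((norm (f t - c))\<^sup>2 * v t) * 1
          \<le> ennreal ((norm (f t - c))\<^sup>2 * v t) * ennreal (4 * l * pker r (t - \<theta>))"
        by (intro mult_left_mono) auto
      then show ?thesis
        using True sub l r pker_nonneg by (auto simp: ennreal_mult ac_simps)
    qed simp
  qed
  also have "\<dots> = ennreal (4 * l) * (\<integral>\<^sup>+ t\<in>dint \<theta> 0. ennreal ((norm (f t - c))\<^sup>2 * v t) * ennreal (pker r (t - \<theta>)) \<partial>lborel)"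
    by (rule nn_integral_cmult) measurable
  also have "\<dots> \<le> ennreal (4 * l) * (ennreal (G\<^sup>2) * ennreal (poisson_const * 2 ^ N * mass (dint \<theta> N)))"
    by (intro mult_left_mono order_trans[OF c] nn_integral_pker_le_mass[OF r(1,2) N]) auto
  also have "\<dots> = ennreal (4 * l * (G\<^sup>2 * (poisson_const * 2 ^ N * mass (dint \<theta> N))))"
    using l poisson_const_nonneg mass_nonneg by (simp add: ennreal_mult)
  also have "\<dots> \<le> ennreal (C * mass {a..<b})"
  proof (rule ennreal_leI)
    \<comment> \<open>The core arc is not much shorter than the given one, since
      \<open>l \<le> pi * h\<close> and \<open>h < 2 * pi / 2 ^ N\<close>.\<close>
    have "l * 2 ^ N \<le> 2 * pi * pi"
    proof -
      have "l * 2 ^ N \<le> pi * h * 2 ^ N" using lh by (intro mult_right_mono) auto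
      also have "\<dots> \<le> pi * (2 * pi / 2 ^ N) * 2 ^ N"
        using N r by (intro mult_right_mono mult_left_mono) auto
      finally show ?thesis by simp
    qed
    moreover have "mass (dint \<theta> N) \<le> mass {a..<b}"
      using N r h by (intro mass_mono[of _ _ a b]) (auto simp: dint_def ends)
    ultimately have "(l * 2 ^ N) * mass (dint \<theta> N) \<le> (2 * pi * pi) * mass {a..<b}"
      by (rule mult_mono) (use l mass_nonneg in auto)
    then have "4 * G\<^sup>2 * poisson_const * ((l * 2 ^ N) * mass (dint \<theta> N))
        \<le> 4 * G\<^sup>2 * poisson_const * ((2 * pi * pi) * mass {a..<b})"
      using poisson_const_nonneg by (intro mult_left_mono) auto
    then show "4 * l * (G\<^sup>2 * (poisson_const * 2 ^ N * mass (dint \<theta> N))) \<le> C * mass {a..<b}"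
      by (simp add: C_def ac_simps)
  qed
  finally have nn: "(\<integral>\<^sup>+ t\<in>{a..<b}. ennreal ((norm (f t - c))\<^sup>2 * v t) \<partial>lborel) \<le> ennreal (C * mass {a..<b})" .
  \<comment> \<open>Integrability of the weighted square follows from the finite bound just
    obtained, and it is what admits Cauchy--Schwarz for Bochner integrals.\<close>
  have int2: "set_integrable lborel {a..<b} (\<lambda>t. (norm (f t - c))\<^sup>2 * v t)"
    unfolding set_integrable_def
  proof (rule integrableI_bounded)
    have "(\<integral>\<^sup>+ t. ennreal (norm (indicat_real {a..<b} t *\<^sub>R ((norm (f t - c))\<^sup>2 * v t))) \<partial>lborel)
        = (\<integral>\<^sup>+ t\<in>{a..<b}. ennreal ((norm (f t - c))\<^sup>2 * v t) \<partial>lborel)"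
      by (intro nn_integral_cong) (auto simp: nonneg abs_mult split: split_indicator)
    also have "\<dots> < \<infinity>" using nn by (rule le_less_trans) simp
    finally show "(\<integral>\<^sup>+ t. ennreal (norm (indicat_real {a..<b} t *\<^sub>R ((norm (f t - c))\<^sup>2 * v t))) \<partial>lborel) < \<infinity>" .
  qed measurable
  have "ennreal (LINT t:{a..<b}|lborel. (norm (f t - c))\<^sup>2 * v t) \<le> ennreal (C * mass {a..<b})"
    using nn by (subst (asm) nn_integral_eq_set_integral[OF int2]) (auto simp: nonneg)
  then have I2: "(LINT t:{a..<b}|lborel. (norm (f t - c))\<^sup>2 * v t) \<le> C * mass {a..<b}"
    using C0 mass_nonneg by (subst (asm) ennreal_le_iff) auto
  have nf: "loc_integrable (\<lambda>t. norm (f t - d))" for d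
    using f by (intro loc_integrable_norm loc_integrable_diff) auto
  have s0: "0 \<le> (LINT t:{a..<b}|lborel. 1 / v t)"
    by (rule set_integral_nonneg_real) (simp add: nonneg)
  have "(LINT t:{a..<b}|lborel. norm (f t - c))\<^sup>2
      \<le> (LINT t:{a..<b}|lborel. (norm (f t - c))\<^sup>2 * v t) * (LINT t:{a..<b}|lborel. 1 / v t)"
    by (rule cauchy_schwarz[of _ a b]) (use int2 loc_integrableD[OF nf] in auto)
  also have "\<dots> \<le> C * mass {a..<b} * (LINT t:{a..<b}|lborel. 1 / v t)"
    using I2 s0 by (rule mult_right_mono)
  also have "\<dots> \<le> C * (A * (b - a)\<^sup>2)"
    using A2[OF ab] C0 unfolding mass_def mult.assoc by (rule mult_left_mono)
  also have "\<dots> = (sqrt (8 * pi * pi * poisson_const * A) * G * (b - a))\<^sup>2"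
    using poisson_const_nonneg A_ge_1 by (simp add: C_def power_mult_distrib)
  finally have Ic: "(LINT t:{a..<b}|lborel. norm (f t - c)) \<le> sqrt (8 * pi * pi * poisson_const * A) * G * (b - a)"
    by (rule power2_le_imp_le) (use poisson_const_nonneg A_ge_1 G ab in auto)
  \<comment> \<open>The mean itself deviates from \<open>c\<close> by at most the average of |f -
    c|, so recentring doubles the bound.\<close>
  have "(LINT t:{a..<b}|lborel. norm (f t - avg f a b))
      \<le> (LINT t:{a..<b}|lborel. norm (f t - c) + norm (avg f a b - c))"
  proof (rule set_integral_mono)
    fix t
    show "norm (f t - avg f a b) \<le> norm (f t - c) + norm (avg f a b - c)"
      by (rule norm_diff_triangle_le) (auto simp: norm_minus_commute)
  qed (use loc_integrableD[OF nf] in \<open>auto intro!: set_integral_add set_integrable_const_subset\<close>)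
  also have "\<dots> = (LINT t:{a..<b}|lborel. norm (f t - c)) + norm (avg f a b - c) * (b - a)"
    using loc_integrableD[OF nf] ab
    by (subst set_integral_add) (auto simp: set_integral_const intro!: set_integrable_const_subset)
  also have "\<dots> \<le> 2 * (LINT t:{a..<b}|lborel. norm (f t - c))"
    using norm_avg_minus_le[OF ab(1) f, of c] by simp
  also have "\<dots> \<le> osc_const * G * (b - a)"
    using Ic by (simp add: osc_const_def)
  finally show "(LINT t:{a..<b}|lborel. norm (f t - avg f a b)) \<le> osc_const * G * (b - a)" .
qed

end

section \<open>Transfer from the circle to the line\<close>

lemma loc_integrableI_period:
  fixes g :: "real \<Rightarrow> 'a::{banach,second_countable_topology}"
  assumes [measurable]: "g \<in> borel_measurable borel"
    and fin: "\<And>a. (\<integral>\<^sup>+ t\<in>{a..<a + 2 * pi}. ennreal (norm (g t)) \<partial>lborel) < \<infinity>"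
  shows "loc_integrable g"
  unfolding loc_integrable_def
proof (intro allI)
  fix a b :: real
  have period: "set_integrable lborel {x..<x + 2 * pi} g" for x
    unfolding set_integrable_def
  proof (rule integrableI_bounded)
    have "(\<integral>\<^sup>+ t. ennreal (norm (indicat_real {x..<x + 2 * pi} t *\<^sub>R g t)) \<partial>lborel)
        = (\<integral>\<^sup>+ t\<in>{x..<x + 2 * pi}. ennreal (norm (g t)) \<partial>lborel)"
      by (intro nn_integral_cong) (auto split: split_indicator)
    then show "(\<integral>\<^sup>+ t. ennreal (norm (indicat_real {x..<x + 2 * pi} t *\<^sub>R g t)) \<partial>lborel) < \<infinity>"
      using fin[of x] by simp
  qed measurable
  have multi: "set_integrable lborel {a..<a + real n * (2 * pi)} g" for n
  proof (induction n)
    case (Suc n)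
    have "{a..<a + real (Suc n) * (2 * pi)}
        = {a..<a + real n * (2 * pi)} \<union> {a + real n * (2 * pi)..<a + real n * (2 * pi) + 2 * pi}"
      by (auto simp: algebra_simps) (smt (verit) mult_nonneg_nonneg of_nat_0_le_iff pi_ge_zero)+
    then show ?case
      using set_integrable_Un[OF Suc period] by simp
  qed simp
  obtain n where "(b - a) / (2 * pi) \<le> real n"
    using real_arch_simple by blast
  then have "b \<le> a + real n * (2 * pi)"
    by (simp add: field_simps)
  then show "set_integrable lborel {a..<b} g"
    by (intro set_integrable_subset[OF multi[of n]]) auto
qed

lemma cis_plus_2pi: "cis (t + 2 * pi) = cis t"
  by (simp add: complex_eq_iff)

lemma pker_periodic: "pker r (t + 2 * pi - \<theta>) = pker r (t - \<theta>)"
  by (simp add: pker_def cos_diff)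

text \<open>Two reciprocals must be reconciled: the extended \<open>inverse\<close> is infinite at
  0, real division gives 0 there. Finiteness of the extended integral forces the weight to be
  positive almost everywhere.\<close>

lemma A2_weight_imp_A2_line:
  assumes "A2_weight w"
  shows "\<exists>A. A2_line (\<lambda>t. w (cis t)) A"
proof -
  define v where "v t = w (cis t)" for t
  have nonneg: "0 \<le> v t" for t
    using assms by (simp add: A2_weight_def v_def)
  have [measurable]: "v \<in> borel_measurable borel"
    using assms by (simp add: A2_weight_def v_def[abs_def])
  obtain C where C: "\<And>a l. 0 < l \<Longrightarrow> l \<le> 2 * pi \<Longrightarrow>
        (\<integral>\<^sup>+ t\<in>{a..a+l}. ennreal (v t) \<partial>lborel) < \<infinity> \<and>
        (\<integral>\<^sup>+ t\<in>{a..a+l}. inverse (ennreal (v t)) \<partial>lborel) < \<infinity> \<and>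
        ennreal (1/l) * (\<integral>\<^sup>+ t\<in>{a..a+l}. ennreal (v t) \<partial>lborel) *
        (ennreal (1/l) * (\<integral>\<^sup>+ t\<in>{a..a+l}. inverse (ennreal (v t)) \<partial>lborel)) \<le> ennreal C"
    using assms unfolding A2_weight_def v_def by auto
  have inv_le: "ennreal (1 / v t) \<le> inverse (ennreal (v t))" for t
    using nonneg[of t] by (cases "v t = 0") (auto simp: inverse_ennreal inverse_eq_divide)
  have sub: "(\<integral>\<^sup>+ t\<in>{a..<a+l}. ennreal (1 / v t) \<partial>lborel)
      \<le> (\<integral>\<^sup>+ t\<in>{a..a+l}. inverse (ennreal (v t)) \<partial>lborel)" for a l
    unfolding nn_integral_atLeastLessThan_Icc by (intro nn_integral_mono mult_right_mono inv_le) simp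
  have int: "loc_integrable v"
  proof (rule loc_integrableI_period)
    fix a
    have "(\<integral>\<^sup>+ t\<in>{a..<a + 2 * pi}. ennreal (v t) \<partial>lborel) < \<infinity>"
      unfolding nn_integral_atLeastLessThan_Icc using C[of "2 * pi" a] by simp
    then show "(\<integral>\<^sup>+ t\<in>{a..<a + 2 * pi}. ennreal (norm (v t)) \<partial>lborel) < \<infinity>"
      by (simp add: nonneg)
  qed simp
  have int_inv: "loc_integrable (\<lambda>t. 1 / v t)"
  proof (rule loc_integrableI_period)
    fix a
    have "(\<integral>\<^sup>+ t\<in>{a..<a + 2 * pi}. ennreal (1 / v t) \<partial>lborel) < \<infinity>"
      using C[of "2 * pi" a] sub[of a "2 * pi"] by (auto intro: le_less_trans)
    then show "(\<integral>\<^sup>+ t\<in>{a..<a + 2 * pi}. ennreal (norm (1 / v t)) \<partial>lborel) < \<infinity>"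
      by (simp add: nonneg)
  qed simp
  have pos_local: "AE t in lborel. t \<in> {a..a + 2 * pi} \<longrightarrow> 0 < v t" for a
  proof -
    have "AE t in lborel. inverse (ennreal (v t)) * indicator {a..a + 2 * pi} t \<noteq> \<infinity>"
      using C[of "2 * pi" a] by (intro nn_integral_noteq_infinite) auto
    then show ?thesis
    proof eventually_elim
      case (elim t)
      then show ?case
        using nonneg[of t] by (cases "v t = 0") auto
    qed
  qed
  \<comment> \<open>Countably many periods cover the line, so their exceptional sets unite to a null
    set.\<close>
  have pos: "AE t in lborel. 0 < v t"
  proof -
    have "AE t in lborel. \<forall>n::int. t \<in> {of_int n * (2 * pi)..of_int n * (2 * pi) + 2 * pi} \<longrightarrow> 0 < v t"
      unfolding AE_all_countable using pos_local by blast
    then show ?thesis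
    proof eventually_elim
      case (elim t)
      define n where "n = \<lfloor>t / (2 * pi)\<rfloor>"
      have "of_int n \<le> t / (2 * pi)" "t / (2 * pi) \<le> of_int n + 1"
        unfolding n_def by linarith+
      then have "t \<in> {of_int n * (2 * pi)..of_int n * (2 * pi) + 2 * pi}"
        by (simp add: field_simps)
      then show ?case using elim by blast
    qed
  qed
  \<comment> \<open>The definition of the weight does not state that \<open>C\<close> is
    nonnegative; the maximum allows \<open>ennreal\<close> to be cancelled.\<close>
  have "A2_line v (max C 0)"
  proof
    fix a b :: real assume ab: "a < b" "b - a \<le> 2 * pi"
    define l where "l = b - a"
    have l: "0 < l" "l \<le> 2 * pi" "b = a + l" using ab by (auto simp: l_def)
    define V S where "V = (LINT t:{a..<b}|lborel. v t)" and "S = (LINT t:{a..<b}|lborel. 1 / v t)"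
    have VS: "0 \<le> V" "0 \<le> S"
      unfolding V_def S_def by (auto intro!: set_integral_nonneg_real simp: nonneg)
    have "ennreal V = (\<integral>\<^sup>+ t\<in>{a..a+l}. ennreal (v t) \<partial>lborel)"
      unfolding V_def l(3)
      by (subst nn_integral_eq_set_integral[symmetric])
        (auto simp: loc_integrableD[OF int] nonneg nn_integral_atLeastLessThan_Icc)
    moreover have "ennreal S \<le> (\<integral>\<^sup>+ t\<in>{a..a+l}. inverse (ennreal (v t)) \<partial>lborel)"
      unfolding S_def l(3)
      by (subst nn_integral_eq_set_integral[symmetric])
        (auto simp: loc_integrableD[OF int_inv] nonneg sub)
    ultimately have "ennreal (1/l) * ennreal V * (ennreal (1/l) * ennreal S)
        \<le> ennreal (1/l) * (\<integral>\<^sup>+ t\<in>{a..a+l}. ennreal (v t) \<partial>lborel) *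
        (ennreal (1/l) * (\<integral>\<^sup>+ t\<in>{a..a+l}. inverse (ennreal (v t)) \<partial>lborel))"
      by (intro mult_mono) auto
    also have "\<dots> \<le> ennreal C" using C[OF l(1,2)] by blast
    also have "\<dots> \<le> ennreal (max C 0)" by (rule ennreal_leI) simp
    also have "ennreal (1/l) * ennreal V * (ennreal (1/l) * ennreal S) = ennreal (1/l * V * (1/l * S))"
      using l VS by (simp only: ennreal_mult[symmetric] mult_nonneg_nonneg divide_nonneg_pos zero_le_one)
    finally have "1/l * V * (1/l * S) \<le> max C 0"
      by (subst (asm) ennreal_le_iff) auto
    then show "V * S \<le> max C 0 * (b - a)\<^sup>2"
      using l by (simp add: l_def[symmetric] field_simps power2_eq_square)
  qed (use nonneg pos int int_inv in auto)
  then show ?thesis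
    unfolding v_def[abs_def] by blast
qed

text \<open>The constant weight serves twice: it exhibits the unweighted norm as a weighted one, and
  it controls the Poisson average of \<open>\<phi>\<close>, taken with respect to arc length
  whatever the weight.\<close>

lemma A2_line_one: "A2_line (\<lambda>_. 1) 1"
  by standard (auto simp: set_integral_const power2_eq_square)

text \<open>The hypothesis gives measurability on one period only; reducing the angle modulo
  \<open>2 * pi\<close> extends it to the line.\<close>

lemma L2_circle_measurable:
  assumes "L2_circle \<phi>"
  shows "(\<lambda>t. \<phi> (cis t)) \<in> borel_measurable borel"
proof -
  define F where "F t = indicat_real {0..2 * pi} t *\<^sub>R \<phi> (cis t)" for t
  have [measurable]: "F \<in> borel_measurable borel"
    using assms by (simp add: L2_circle_def set_borel_measurable_def F_def[abs_def])
  have "\<phi> (cis t) = F (t - of_int \<lfloor>t / (2 * pi)\<rfloor> * (2 * pi))" for t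
  proof -
    interpret periodic_fun_simple cis "2 * pi" by standard (rule cis_plus_2pi)
    define n where "n = \<lfloor>t / (2 * pi)\<rfloor>"
    have "of_int n \<le> t / (2 * pi)" "t / (2 * pi) \<le> of_int n + 1"
      unfolding n_def by linarith+
    then have "t - of_int n * (2 * pi) \<in> {0..2 * pi}"
      by (simp add: field_simps)
    then show ?thesis
      unfolding n_def[symmetric] by (simp add: F_def minus_of_int)
  qed
  then show ?thesis by simp
qed

lemma L2_circle_loc_integrable:
  assumes "L2_circle \<phi>"
  shows "loc_integrable (\<lambda>t. \<phi> (cis t))"
proof (rule loc_integrableI_period)
  note [measurable] = L2_circle_measurable[OF assms]
  show "(\<lambda>t. \<phi> (cis t)) \<in> borel_measurable borel" by simp
  fix a
  have "(\<integral>\<^sup>+ t\<in>{a..<a + 2 * pi}. ennreal (norm (\<phi> (cis t))) \<partial>lborel)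
      = (\<integral>\<^sup>+ t\<in>{0..2 * pi}. ennreal (norm (\<phi> (cis t))) \<partial>lborel)"
    by (rule nn_integral_periodic) (auto simp: cis_plus_2pi)
  also have "\<dots> \<le> (\<integral>\<^sup>+ t\<in>{0..2 * pi}. (1 + ennreal ((norm (\<phi> (cis t)))\<^sup>2)) \<partial>lborel)"
  proof (intro nn_integral_mono mult_right_mono)
    fix t
    have "x \<le> 1 + x\<^sup>2" for x :: real
      using zero_le_power2[of "x - 1 / 2"] by (simp add: power2_eq_square algebra_simps)
    then have "ennreal (norm (\<phi> (cis t))) \<le> ennreal (1 + (norm (\<phi> (cis t)))\<^sup>2)"
      by (intro ennreal_leI)
    then show "ennreal (norm (\<phi> (cis t))) \<le> 1 + ennreal ((norm (\<phi> (cis t)))\<^sup>2)"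
      by simp
  qed simp
  also have "\<dots> = (\<integral>\<^sup>+ t\<in>{0..2 * pi}. 1 \<partial>lborel) + (\<integral>\<^sup>+ t\<in>{0..2 * pi}. ennreal ((norm (\<phi> (cis t)))\<^sup>2) \<partial>lborel)"
    by (rule nn_set_integral_add) auto
  also have "(\<integral>\<^sup>+ t\<in>{0..2 * pi}. ennreal ((norm (\<phi> (cis t)))\<^sup>2) \<partial>lborel)
      = ennreal (LINT t:{0..2 * pi}|lborel. (norm (\<phi> (cis t)))\<^sup>2)"
    by (rule nn_integral_eq_set_integral) (use assms in \<open>auto simp: L2_circle_def\<close>)
  also have "(\<integral>\<^sup>+ t\<in>{0..2 * pi}. 1 \<partial>lborel) = ennreal (2 * pi)"
    by simp
  finally show "(\<integral>\<^sup>+ t\<in>{a..<a + 2 * pi}. ennreal (norm (\<phi> (cis t))) \<partial>lborel) < \<infinity>"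
    by (rule le_less_trans) simp
qed

section \<open>Garsia norms in polar coordinates\<close>

lemma ball_polar:
  assumes "z \<in> ball (0::complex) 1"
  obtains r \<theta> where "0 \<le> r" "r < 1" "z = of_real r * cis \<theta>"
  using that[of "cmod z" "Arg z"] assms rcis_cmod_Arg[of z] by (auto simp: rcis_def)

lemma nn_integral_dint_circle:
  fixes g :: "complex \<Rightarrow> ennreal"
  assumes [measurable]: "(\<lambda>t. g (cis t)) \<in> borel_measurable borel"
  shows "(\<integral>\<^sup>+ t\<in>dint \<theta> 0. g (cis t) * ennreal (pker r (t - \<theta>)) \<partial>lborel)
    = (\<integral>\<^sup>+ t\<in>{0..2 * pi}. g (cis t) * ennreal (pker r (t - \<theta>)) \<partial>lborel)"
  by (rule nn_integral_dint_0) (auto simp: pker_periodic cis_plus_2pi)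

text \<open>Positivity makes the division in the weighted norm a genuine one. The identity needs
  finiteness, since the Bochner integral of a non-integrable function is 0.\<close>

lemma poisson_ext_weight:
  assumes "A2_line (\<lambda>t. w (cis t)) A" "0 \<le> r" "r < 1"
  shows "poisson_ext w (of_real r * cis \<theta>) > 0"
    and "(\<integral>\<^sup>+ t\<in>dint \<theta> 0. ennreal (w (cis t)) * ennreal (pker r (t - \<theta>)) \<partial>lborel)
      = ennreal (2 * pi * poisson_ext w (of_real r * cis \<theta>))"
proof -
  interpret A2_line "\<lambda>t. w (cis t)" A by (rule assms)
  obtain N where N: "pi / 2 ^ N \<le> 1 - r" "1 - r < 2 * pi / 2 ^ N"
    using dyadic_scale[of "1 - r"] assms by auto
  define R where "R = (\<integral>\<^sup>+ t\<in>dint \<theta> 0. ennreal (w (cis t)) * ennreal (pker r (t - \<theta>)) \<partial>lborel)"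
  have R: "R = (\<integral>\<^sup>+ t\<in>{0..2 * pi}. ennreal (pker r (t - \<theta>) * w (cis t)) \<partial>lborel)"
    unfolding R_def using nonneg pker_nonneg[OF assms(2,3)]
    by (subst nn_integral_dint_circle) (auto simp: ennreal_mult mult.commute)
  have "R < \<infinity>"
    unfolding R_def using nn_integral_pker_le_mass[OF assms(2,3) N] by (rule le_less_trans) simp
  have int: "set_integrable lborel {0..2 * pi} (\<lambda>t. pker r (t - \<theta>) * w (cis t))"
    unfolding set_integrable_def
  proof (rule integrableI_bounded)
    have "(\<integral>\<^sup>+ t. ennreal (norm (indicat_real {0..2 * pi} t *\<^sub>R (pker r (t - \<theta>) * w (cis t)))) \<partial>lborel) = R"
      unfolding R using nonneg pker_nonneg[OF assms(2,3)]
      by (intro nn_integral_cong) (auto simp: abs_mult split: split_indicator)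
    then show "(\<integral>\<^sup>+ t. ennreal (norm (indicat_real {0..2 * pi} t *\<^sub>R (pker r (t - \<theta>) * w (cis t)))) \<partial>lborel) < \<infinity>"
      using \<open>R < \<infinity>\<close> by simp
  qed measurable
  have ext: "2 * pi * poisson_ext w (of_real r * cis \<theta>) = (LINT t:{0..2 * pi}|lborel. pker r (t - \<theta>) * w (cis t))"
    by (simp add: poisson_ext_def poisson_kernel_polar pker_def)
  show 1: "(\<integral>\<^sup>+ t\<in>dint \<theta> 0. ennreal (w (cis t)) * ennreal (pker r (t - \<theta>)) \<partial>lborel)
      = ennreal (2 * pi * poisson_ext w (of_real r * cis \<theta>))"
    unfolding ext R_def[symmetric] R
    by (rule nn_integral_eq_set_integral[OF int]) (simp add: nonneg pker_nonneg[OF assms(2,3)])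
  have "0 < ennreal (2 ^ N / (8 * pi) * mass (dint \<theta> N))"
    using mass_dint_pos[of \<theta> N] by (subst ennreal_less_zero_iff) simp
  also note nn_integral_pker_ge_mass[OF assms(2,3) N]
  finally show "poisson_ext w (of_real r * cis \<theta>) > 0"
    unfolding 1 by (simp add: zero_less_mult_iff)
qed

lemma ennsqrt_le_iff:
  assumes "0 \<le> g"
  shows "ennsqrt x \<le> ennreal g \<longleftrightarrow> x \<le> ennreal (g\<^sup>2)"
proof (cases x)
  case (real y)
  have "sqrt y \<le> g \<longleftrightarrow> y \<le> g\<^sup>2"
    using real assms by (simp add: real_sqrt_le_iff' real_le_rsqrt sqrt_le_D real_le_lsqrt)
  then show ?thesis
    using real assms by (simp add: ennsqrt_def)
qed (simp add: ennsqrt_def top_unique)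

text \<open>A finite bound on the norm becomes a family of integral inequalities without roots or
  quotients, the form that the local estimates produce and consume. Periodicity allows the period to
  be centred at \<open>\<theta>\<close>.\<close>

lemma garsia_norm_w_le_iff:
  fixes w :: "complex \<Rightarrow> real"
  assumes w: "A2_line (\<lambda>t. w (cis t)) A" and [measurable]: "(\<lambda>t. \<phi> (cis t)) \<in> borel_measurable borel"
    and g: "0 \<le> g"
  shows "garsia_norm_w w \<phi> \<le> ennreal g \<longleftrightarrow> (\<forall>r \<theta>. 0 \<le> r \<longrightarrow> r < 1 \<longrightarrow>
    (\<integral>\<^sup>+ t\<in>dint \<theta> 0. ennreal ((norm (\<phi> (cis t) - poisson_ext \<phi> (of_real r * cis \<theta>)))\<^sup>2 * w (cis t))
        * ennreal (pker r (t - \<theta>)) \<partial>lborel)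
      \<le> ennreal (g\<^sup>2) * (\<integral>\<^sup>+ t\<in>dint \<theta> 0. ennreal (w (cis t)) * ennreal (pker r (t - \<theta>)) \<partial>lborel))"
    (is "_ \<longleftrightarrow> (\<forall>r \<theta>. _ \<longrightarrow> _ \<longrightarrow> ?P r \<theta>)")
proof -
  interpret A2_line "\<lambda>t. w (cis t)" A by (rule w)
  define Q where "Q z = ennsqrt (ennreal (1 / poisson_ext w z) *
      ((\<integral>\<^sup>+ t\<in>{0..2*pi}. ennreal ((cmod (\<phi> (cis t) - poisson_ext \<phi> z))^2
          * poisson_kernel z (cis t) * w (cis t)) \<partial>lborel) / ennreal (2*pi)))" for z
  have Q: "Q (of_real r * cis \<theta>) \<le> ennreal g \<longleftrightarrow> ?P r \<theta>" if r: "0 \<le> r" "r < 1" for r \<theta>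
  proof -
    define z where "z = of_real r * cis \<theta>"
    define I where "I = (\<integral>\<^sup>+ t\<in>dint \<theta> 0. ennreal ((norm (\<phi> (cis t) - poisson_ext \<phi> z))\<^sup>2 * w (cis t))
        * ennreal (pker r (t - \<theta>)) \<partial>lborel)"
    have "I = (\<integral>\<^sup>+ t\<in>{0..2*pi}. ennreal ((cmod (\<phi> (cis t) - poisson_ext \<phi> z))^2 * w (cis t))
        * ennreal (pker r (t - \<theta>)) \<partial>lborel)"
      unfolding I_def
      by (rule nn_integral_dint_circle[where g="\<lambda>x. ennreal ((cmod (\<phi> x - poisson_ext \<phi> z))^2 * w x)"]) simp
    also have "\<dots> = (\<integral>\<^sup>+ t\<in>{0..2*pi}. ennreal ((cmod (\<phi> (cis t) - poisson_ext \<phi> z))^2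
          * poisson_kernel z (cis t) * w (cis t)) \<partial>lborel)"
      using nonneg pker_nonneg[OF r] unfolding z_def poisson_kernel_polar pker_def[symmetric]
      by (intro nn_integral_cong) (simp add: ennreal_mult ac_simps)
    finally have I: "Q z = ennsqrt (ennreal (1 / poisson_ext w z) * (I / ennreal (2 * pi)))"
      unfolding Q_def by simp
    define W where "W = poisson_ext w z"
    have W: "W > 0" unfolding W_def z_def by (rule poisson_ext_weight[OF w r])
    have "Q z \<le> ennreal g \<longleftrightarrow> ennreal (1 / W) * (I / ennreal (2 * pi)) \<le> ennreal (g\<^sup>2)"
      unfolding I W_def[symmetric] by (rule ennsqrt_le_iff[OF g])
    also have "\<dots> \<longleftrightarrow> I \<le> ennreal (g\<^sup>2) * ennreal (2 * pi * W)"
    proof (cases I)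
      case (real y)
      have "ennreal (1 / W) * (I / ennreal (2 * pi)) = ennreal (1 / W * (y / (2 * pi)))"
        using real W by (simp add: divide_ennreal flip: ennreal_mult)
      moreover have "ennreal (g\<^sup>2) * ennreal (2 * pi * W) = ennreal (g\<^sup>2 * (2 * pi * W))"
        using W by (simp flip: ennreal_mult)
      moreover have "1 / W * (y / (2 * pi)) \<le> g\<^sup>2 \<longleftrightarrow> y \<le> g\<^sup>2 * (2 * pi * W)"
        using W by (simp add: field_simps)
      ultimately show ?thesis using real W by simp
    next
      case top
      then show ?thesis
        using W by (simp add: ennreal_top_divide ennreal_mult_top top_unique ennreal_mult_eq_top_iff)
    qed
    also have "ennreal (2 * pi * W)
        = (\<integral>\<^sup>+ t\<in>dint \<theta> 0. ennreal (w (cis t)) * ennreal (pker r (t - \<theta>)) \<partial>lborel)"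
      unfolding W_def z_def by (rule poisson_ext_weight(2)[OF w r, symmetric])
    finally show ?thesis unfolding z_def I_def .
  qed
  have "garsia_norm_w w \<phi> \<le> ennreal g \<longleftrightarrow> (\<forall>z\<in>ball 0 1. Q z \<le> ennreal g)"
    unfolding garsia_norm_w_def Q_def by (rule SUP_le_iff)
  also have "\<dots> \<longleftrightarrow> (\<forall>r \<theta>. 0 \<le> r \<longrightarrow> r < 1 \<longrightarrow> ?P r \<theta>)"
  proof (intro iffI allI impI ballI)
    fix r \<theta> :: real assume Qz: "\<forall>z\<in>ball 0 1. Q z \<le> ennreal g" and r: "0 \<le> r" "r < 1"
    have "of_real r * cis \<theta> \<in> ball 0 1" using r by (simp add: norm_mult)
    then show "?P r \<theta>" using Qz Q[OF r] by blast
  next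
    fix z :: complex assume P: "\<forall>r \<theta>. 0 \<le> r \<longrightarrow> r < 1 \<longrightarrow> ?P r \<theta>" and "z \<in> ball 0 1"
    then obtain r \<theta> where r: "0 \<le> r" "r < 1" "z = of_real r * cis \<theta>"
      using ball_polar by blast
    then show "Q z \<le> ennreal g" using P Q[OF r(1,2)] by blast
  qed
  finally show ?thesis .
qed

section \<open>The unweighted norm as a special case, and the comparison of norms\<close>

lemma poisson_ext_one:
  assumes "z \<in> ball 0 1"
  shows "poisson_ext (\<lambda>_. 1::real) z = 1"
proof -
  obtain r \<theta> where r: "0 \<le> r" "r < 1" "z = of_real r * cis \<theta>"
    using ball_polar[OF assms] .
  have "ennreal (2 * pi * poisson_ext (\<lambda>_. 1::real) z) = (\<integral>\<^sup>+ t\<in>dint \<theta> 0. ennreal (pker r (t - \<theta>)) \<partial>lborel)"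
    using poisson_ext_weight(2)[OF A2_line_one r(1,2), of \<theta>] r(3) by simp
  also have "\<dots> = ennreal (2 * pi)"
    using nn_integral_dint_circle[of "\<lambda>_. 1" r \<theta>] nn_integral_pker[OF r(1,2)] by simp
  finally have "ennreal (2 * pi * poisson_ext (\<lambda>_. 1::real) z) = ennreal (2 * pi)" .
  then have "2 * pi * poisson_ext (\<lambda>_. 1::real) z = 2 * pi"
    using poisson_ext_weight(1)[OF A2_line_one r(1,2), of \<theta>] r(3) by (subst (asm) ennreal_inj) auto
  then show ?thesis by simp
qed

lemma garsia_norm_eq: "garsia_norm \<phi> = garsia_norm_w (\<lambda>_. 1) \<phi>"
  unfolding garsia_norm_def garsia_norm_w_def
  by (intro SUP_cong refl) (simp add: poisson_ext_one)

text \<open>The distance is at most the Poisson mean of |f - c|. This is a mean with respect to arc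
  length, so the estimate for the constant weight applies, hence
  \<open>A2_line.garsia_const 1\<close>.\<close>

lemma poisson_ext_near_avg:
  fixes \<phi> :: "complex \<Rightarrow> complex"
  defines "f \<equiv> \<lambda>t. \<phi> (cis t)"
  assumes f: "loc_integrable f" "f \<in> borel_measurable borel" and B: "B > 0" "osc_le f B"
    and r: "0 \<le> r" "r < 1" and N: "pi / 2 ^ N \<le> 1 - r" "1 - r < 2 * pi / 2 ^ N"
    and c: "c = avg f (\<theta> - pi / 2 ^ N) (\<theta> + pi / 2 ^ N)"
  shows "norm (poisson_ext \<phi> (of_real r * cis \<theta>) - c) \<le> (1 + A2_line.garsia_const 1) * B"
proof -
  interpret one: A2_line "\<lambda>_. 1" 1 by (rule A2_line_one)
  note f(2) [measurable]
  have P0: "0 \<le> pker r s" for s by (rule pker_nonneg[OF r])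
  have mass: "(\<integral>\<^sup>+ t\<in>dint \<theta> 0. ennreal (pker r (t - \<theta>)) \<partial>lborel) = ennreal (2 * pi)"
    using nn_integral_dint_circle[of "\<lambda>_. 1" r \<theta>] nn_integral_pker[OF r] by simp
  have sq: "(\<integral>\<^sup>+ t\<in>dint \<theta> 0. ennreal ((norm (f t - c))\<^sup>2) * ennreal (pker r (t - \<theta>)) \<partial>lborel)
      \<le> ennreal (one.garsia_const * B\<^sup>2) * ennreal (2 * pi)"
    using one.garsia_integral_avg_le[OF f B r N c] by (simp add: mass)
  have "(\<integral>\<^sup>+ t\<in>{0..2 * pi}. ennreal (pker r (t - \<theta>) * norm (f t - c)) \<partial>lborel)
      = (\<integral>\<^sup>+ t\<in>{0..2 * pi}. ennreal (norm (f t - c)) * ennreal (pker r (t - \<theta>)) \<partial>lborel)"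
    using P0 by (intro nn_integral_cong) (simp add: ennreal_mult mult.commute)
  also have "\<dots> = (\<integral>\<^sup>+ t\<in>dint \<theta> 0. ennreal (norm (f t - c)) * ennreal (pker r (t - \<theta>)) \<partial>lborel)"
    using f(2) nn_integral_dint_circle[of "\<lambda>x. ennreal (norm (\<phi> x - c))" r \<theta>] by (simp add: f_def)
  also have "\<dots> \<le> (\<integral>\<^sup>+ t. ennreal B * (ennreal (pker r (t - \<theta>)) * indicator (dint \<theta> 0) t)
      + ennreal (1 / B) * (ennreal ((norm (f t - c))\<^sup>2) * ennreal (pker r (t - \<theta>)) * indicator (dint \<theta> 0) t) \<partial>lborel)"
  proof (rule nn_integral_mono)
    fix t
    define x where "x = norm (f t - c)"
    \<comment> \<open>Bounding \<open>x\<close> by \<open>B\<close> plus its square over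
      \<open>B\<close> replaces Cauchy--Schwarz; after integration both terms are multiples of
      \<open>B\<close>.\<close>
    have "0 \<le> (x - B)\<^sup>2 / B + x" using B by (simp add: x_def)
    then have "x \<le> B + 1 / B * x\<^sup>2"
      using B by (simp add: field_simps power2_eq_square)
    then have "ennreal x \<le> ennreal (B + 1 / B * x\<^sup>2)" by (rule ennreal_leI)
    also have "\<dots> = ennreal B + ennreal (1 / B) * ennreal (x\<^sup>2)"
      using B by (subst ennreal_plus, simp, simp, subst ennreal_mult) auto
    finally have "ennreal x * (ennreal (pker r (t - \<theta>)) * indicator (dint \<theta> 0) t)
        \<le> (ennreal B + ennreal (1 / B) * ennreal (x\<^sup>2)) * (ennreal (pker r (t - \<theta>)) * indicator (dint \<theta> 0) t)"
      by (rule mult_right_mono) simp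
    then show "ennreal (norm (f t - c)) * ennreal (pker r (t - \<theta>)) * indicator (dint \<theta> 0) t
      \<le> ennreal B * (ennreal (pker r (t - \<theta>)) * indicator (dint \<theta> 0) t)
      + ennreal (1 / B) * (ennreal ((norm (f t - c))\<^sup>2) * ennreal (pker r (t - \<theta>)) * indicator (dint \<theta> 0) t)"
      unfolding x_def by (simp only: distrib_right mult.assoc)
  qed
  also have "\<dots> = ennreal B * ennreal (2 * pi) + ennreal (1 / B)
      * (\<integral>\<^sup>+ t\<in>dint \<theta> 0. ennreal ((norm (f t - c))\<^sup>2) * ennreal (pker r (t - \<theta>)) \<partial>lborel)"
    by (simp add: nn_integral_add nn_integral_cmult mass)
  also have "\<dots> \<le> ennreal B * ennreal (2 * pi) + ennreal (1 / B) * (ennreal (one.garsia_const * B\<^sup>2) * ennreal (2 * pi))"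
    by (intro add_left_mono mult_left_mono sq) simp
  also have "\<dots> = ennreal (B * (2 * pi) + 1 / B * (one.garsia_const * B\<^sup>2 * (2 * pi)))"
    using B one.garsia_const_nonneg
    by (simp only: ennreal_mult[symmetric] ennreal_plus[symmetric] mult_nonneg_nonneg zero_le_power2
        divide_nonneg_pos zero_le_one less_imp_le pi_ge_zero zero_le_numeral)
  also have "B * (2 * pi) + 1 / B * (one.garsia_const * B\<^sup>2 * (2 * pi)) = 2 * pi * ((1 + one.garsia_const) * B)"
    using B by (simp add: field_simps power2_eq_square)
  finally have L1: "(\<integral>\<^sup>+ t\<in>{0..2 * pi}. ennreal (pker r (t - \<theta>) * norm (f t - c)) \<partial>lborel)
      \<le> ennreal (2 * pi * ((1 + one.garsia_const) * B))" .
  have nn: "(\<integral>\<^sup>+ t. ennreal (norm (indicat_real {0..2 * pi} t *\<^sub>R (of_real (pker r (t - \<theta>)) * (f t - c)))) \<partial>lborel)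
      = (\<integral>\<^sup>+ t\<in>{0..2 * pi}. ennreal (pker r (t - \<theta>) * norm (f t - c)) \<partial>lborel)"
    using P0 by (intro nn_integral_cong) (auto simp: norm_mult split: split_indicator)
  have int: "set_integrable lborel {0..2 * pi} (\<lambda>t. of_real (pker r (t - \<theta>)) * (f t - c))"
    unfolding set_integrable_def
  proof (rule integrableI_bounded)
    show "(\<integral>\<^sup>+ t. ennreal (norm (indicat_real {0..2 * pi} t *\<^sub>R (of_real (pker r (t - \<theta>)) * (f t - c)))) \<partial>lborel) < \<infinity>"
      unfolding nn using L1 by (rule le_less_trans) simp
  qed measurable
  have intP: "set_integrable lborel {0..2 * pi} (\<lambda>t. complex_of_real (pker r (t - \<theta>)))"
    unfolding set_integrable_def
  proof (rule integrableI_bounded)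
    have "(\<integral>\<^sup>+ t. ennreal (norm (indicat_real {0..2 * pi} t *\<^sub>R complex_of_real (pker r (t - \<theta>)))) \<partial>lborel)
        = (\<integral>\<^sup>+ t\<in>{0..2 * pi}. ennreal (pker r (t - \<theta>)) \<partial>lborel)"
      using P0 by (intro nn_integral_cong) (auto split: split_indicator)
    then show "(\<integral>\<^sup>+ t. ennreal (norm (indicat_real {0..2 * pi} t *\<^sub>R complex_of_real (pker r (t - \<theta>)))) \<partial>lborel) < \<infinity>"
      by (simp add: nn_integral_pker[OF r])
  qed measurable
  have mass1: "(LINT t:{0..2 * pi}|lborel. complex_of_real (pker r (t - \<theta>))) = of_real (2 * pi)"
  proof -
    have "of_real r * cis \<theta> \<in> ball 0 1" using r by (simp add: norm_mult)
    from poisson_ext_one[OF this]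
    have "(LINT t:{0..2 * pi}|lborel. pker r (t - \<theta>)) = 2 * pi"
      by (simp add: poisson_ext_def poisson_kernel_polar pker_def)
    then show ?thesis
      by (simp only: set_integral_complex_of_real)
  qed
  define X where "X = (LINT t:{0..2 * pi}|lborel. of_real (pker r (t - \<theta>)) * (f t - c))"
  have "(LINT t:{0..2 * pi}|lborel. of_real (pker r (t - \<theta>)) * f t)
      = (LINT t:{0..2 * pi}|lborel. of_real (pker r (t - \<theta>)) * (f t - c) + of_real (pker r (t - \<theta>)) * c)"
    by (simp add: algebra_simps)
  also have "\<dots> = X + of_real (2 * pi) * c"
    using int intP unfolding X_def mass1[symmetric] by (subst set_integral_add) auto
  finally have "poisson_ext \<phi> (of_real r * cis \<theta>) = (X + of_real (2 * pi) * c) / of_real (2 * pi)"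
    by (simp add: poisson_ext_def poisson_kernel_polar pker_def f_def)
  then have eq: "poisson_ext \<phi> (of_real r * cis \<theta>) - c = X / of_real (2 * pi)"
    by (simp add: field_simps)
  have "ennreal (norm X) \<le> ennreal (2 * pi * ((1 + one.garsia_const) * B))"
  proof -
    have "ennreal (norm X) \<le> (\<integral>\<^sup>+ t. ennreal (norm (indicat_real {0..2 * pi} t *\<^sub>R (of_real (pker r (t - \<theta>)) * (f t - c)))) \<partial>lborel)"
      unfolding X_def set_lebesgue_integral_def
      by (rule integral_norm_bound_ennreal) (use int in \<open>simp add: set_integrable_def\<close>)
    then show ?thesis unfolding nn using L1 by (rule order_trans)
  qed
  then have "norm X \<le> 2 * pi * ((1 + one.garsia_const) * B)"
    using one.garsia_const_nonneg B by (subst (asm) ennreal_le_iff) auto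
  then show ?thesis
    unfolding eq by (simp add: norm_divide field_simps)
qed

text \<open>The centre moves from the mean over the core arc to the Poisson average; the two terms
  under the root are the two terms of this recentring.\<close>

lemma garsia_norm_w_le_of_osc:
  fixes \<phi> :: "complex \<Rightarrow> complex" and w :: "complex \<Rightarrow> real"
  defines "f \<equiv> \<lambda>t. \<phi> (cis t)"
  assumes w: "A2_line (\<lambda>t. w (cis t)) A"
    and f: "loc_integrable f" "f \<in> borel_measurable borel" and B: "B > 0" "osc_le f B"
  shows "garsia_norm_w w \<phi>
    \<le> ennreal (sqrt (2 * A2_line.garsia_const A + 2 * (1 + A2_line.garsia_const 1)\<^sup>2) * B)"
proof -
  interpret A2_line "\<lambda>t. w (cis t)" A by (rule w)
  interpret one: A2_line "\<lambda>_. 1" 1 by (rule A2_line_one)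
  note f(2) [measurable]
  define M where "M = (1 + one.garsia_const) * B"
  have M0: "0 \<le> M" using one.garsia_const_nonneg B by (simp add: M_def)
  define K where "K = sqrt (2 * garsia_const + 2 * (1 + one.garsia_const)\<^sup>2)"
  have K2: "(K * B)\<^sup>2 = 2 * (garsia_const * B\<^sup>2) + 2 * M\<^sup>2"
  proof -
    have "K\<^sup>2 = 2 * garsia_const + 2 * (1 + one.garsia_const)\<^sup>2"
      using garsia_const_nonneg by (simp add: K_def)
    then show ?thesis
      unfolding M_def power_mult_distrib by (simp only: distrib_right mult.assoc)
  qed
  have "garsia_norm_w w \<phi> \<le> ennreal (K * B)"
  proof (subst garsia_norm_w_le_iff[OF w], goal_cases)
    case 1
    show ?case using f(2) by (simp add: f_def)
  next
    case 2
    show ?case using B garsia_const_nonneg by (simp add: K_def)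
  next
    case 3
    show ?case
    proof (intro allI impI)
      fix r \<theta> :: real assume r: "0 \<le> r" "r < 1"
      obtain N where N: "pi / 2 ^ N \<le> 1 - r" "1 - r < 2 * pi / 2 ^ N"
        using dyadic_scale[of "1 - r"] r by auto
      define c where "c = avg f (\<theta> - pi / 2 ^ N) (\<theta> + pi / 2 ^ N)"
      define p where "p = poisson_ext \<phi> (of_real r * cis \<theta>)"
      let ?R = "\<integral>\<^sup>+ t\<in>dint \<theta> 0. ennreal (w (cis t)) * ennreal (pker r (t - \<theta>)) \<partial>lborel"
      have "norm (p - c) \<le> M"
        unfolding p_def M_def
        by (rule poisson_ext_near_avg[OF f[unfolded f_def] B(1) B(2)[unfolded f_def] r N c_def[unfolded f_def]])
      then have pc: "(norm (c - p))\<^sup>2 \<le> M\<^sup>2"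
        by (intro power_mono) (auto simp: norm_minus_commute)
      have "(\<integral>\<^sup>+ t\<in>dint \<theta> 0. ennreal ((norm (f t - p))\<^sup>2 * w (cis t)) * ennreal (pker r (t - \<theta>)) \<partial>lborel)
          \<le> 2 * (\<integral>\<^sup>+ t\<in>dint \<theta> 0. ennreal ((norm (f t - c))\<^sup>2 * w (cis t)) * ennreal (pker r (t - \<theta>)) \<partial>lborel)
            + ennreal (2 * (norm (c - p))\<^sup>2) * ?R"
        by (rule nn_integral_square_shift) auto
      also have "\<dots> \<le> 2 * (ennreal (garsia_const * B\<^sup>2) * ?R) + ennreal (2 * M\<^sup>2) * ?R"
        by (intro add_mono mult_left_mono mult_right_mono garsia_integral_avg_le[OF f B r N c_def] ennreal_leI pc) auto
      also have "\<dots> = ennreal ((K * B)\<^sup>2) * ?R"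
        unfolding K2 using garsia_const_nonneg
        by (subst ennreal_plus) (auto simp: ennreal_mult distrib_right mult.assoc)
      finally show "(\<integral>\<^sup>+ t\<in>dint \<theta> 0. ennreal ((norm (\<phi> (cis t) - poisson_ext \<phi> (of_real r * cis \<theta>)))\<^sup>2 * w (cis t))
            * ennreal (pker r (t - \<theta>)) \<partial>lborel) \<le> ennreal ((K * B)\<^sup>2) * ?R"
        by (simp add: f_def p_def)
    qed
  qed
  then show ?thesis by (simp add: K_def)
qed

text \<open>The norm for \<open>w'\<close> bounds the mean oscillation, which in turn bounds the
  norm for \<open>w\<close>. The constant is built from \<open>A\<close> and \<open>A'\<close>
  before \<open>\<phi>\<close> is chosen.\<close>

lemma garsia_norm_w_compare:
  assumes w: "A2_line (\<lambda>t. w (cis t)) A" and w': "A2_line (\<lambda>t. w' (cis t)) A'"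
  shows "\<exists>C>0. \<forall>\<phi>. L2_circle \<phi> \<longrightarrow> garsia_norm_w w \<phi> \<le> ennreal C * garsia_norm_w w' \<phi>"
proof -
  interpret A2_line "\<lambda>t. w (cis t)" A by (rule w)
  interpret p: A2_line "\<lambda>t. w' (cis t)" A' by (rule w')
  interpret one: A2_line "\<lambda>_. 1" 1 by (rule A2_line_one)
  define K where "K = sqrt (2 * garsia_const + 2 * (1 + one.garsia_const)\<^sup>2)"
  define C where "C = K * (p.osc_const + 1)"
  have "0 < (1 + one.garsia_const)\<^sup>2"
    using one.garsia_const_nonneg by (intro zero_less_power) auto
  then have K: "K > 0"
    unfolding K_def real_sqrt_gt_0_iff using garsia_const_nonneg by linarith
  have C: "C > 0" using K p.osc_const_nonneg by (simp add: C_def)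
  have "garsia_norm_w w \<phi> \<le> ennreal C * garsia_norm_w w' \<phi>" if \<phi>: "L2_circle \<phi>" for \<phi>
  proof (cases "garsia_norm_w w' \<phi>")
    case top
    then show ?thesis using C by (simp add: ennreal_mult_top)
  next
    case (real g)
    define f where "f t = \<phi> (cis t)" for t
    have f: "loc_integrable f" "f \<in> borel_measurable borel"
      using L2_circle_loc_integrable[OF \<phi>] L2_circle_measurable[OF \<phi>] by (simp_all add: f_def[abs_def])
    have osc: "osc_le f (p.osc_const * g)"
    proof (rule p.osc_le_of_garsia[OF f])
      show "0 \<le> g" using real by simp
      fix r \<theta> :: real assume "0 \<le> r" "r < 1"
      then show "\<exists>c. (\<integral>\<^sup>+ t\<in>dint \<theta> 0. ennreal ((norm (f t - c))\<^sup>2 * w' (cis t)) * ennreal (pker r (t - \<theta>)) \<partial>lborel)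
        \<le> ennreal (g\<^sup>2) * (\<integral>\<^sup>+ t\<in>dint \<theta> 0. ennreal (w' (cis t)) * ennreal (pker r (t - \<theta>)) \<partial>lborel)"
        using garsia_norm_w_le_iff[OF w' L2_circle_measurable[OF \<phi>], of g] real
        unfolding f_def by auto
    qed
    show ?thesis
    proof (rule ennreal_le_epsilon)
      fix e :: real assume e: "0 < e"
      \<comment> \<open>The upper bound asks for a positive \<open>B\<close>, while \<open>g\<close>
        and \<open>p.osc_const\<close> may vanish; hence the summands \<open>e / C\<close> and 1. By
        the choice of \<open>C\<close>, the surplus in \<open>K * B\<close> is exactly
        \<open>e\<close>.\<close>
      define B where "B = (p.osc_const + 1) * (g + e / C)"
      have g: "0 \<le> g" "0 < g + e / C" using real e C by (auto simp: add_nonneg_pos)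
      then have B: "B > 0" using p.osc_const_nonneg by (simp add: B_def)
      have "p.osc_const * g \<le> B"
        unfolding B_def using p.osc_const_nonneg g e C by (intro mult_mono) auto
      then have "osc_le f B"
        using osc unfolding osc_le_def by (smt (verit) mult_right_mono)
      then have "garsia_norm_w w \<phi> \<le> ennreal (K * B)"
        using garsia_norm_w_le_of_osc[OF w _ _ B] f unfolding K_def f_def by simp
      also have "K * B = C * g + e"
        using C by (simp add: B_def C_def field_simps)
      also have "ennreal \<dots> = ennreal C * garsia_norm_w w' \<phi> + ennreal e"
        using C e g real by (simp add: ennreal_mult)
      finally show "garsia_norm_w w \<phi> \<le> ennreal C * garsia_norm_w w' \<phi> + ennreal e" .
    qed
  qed
  then show ?thesis using C by blast
qed

theorem theorem1p4:
  fixes w :: "complex \<Rightarrow> real"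
  assumes "A2_weight w"
  shows "\<exists>C::real. C > 0 \<and> (\<forall>\<phi>. L2_circle \<phi> \<longrightarrow>
           garsia_norm_w w \<phi> \<le> ennreal C * garsia_norm \<phi> \<and>
           garsia_norm \<phi> \<le> ennreal C * garsia_norm_w w \<phi>)"
proof -
  obtain A where w: "A2_line (\<lambda>t. w (cis t)) A"
    using A2_weight_imp_A2_line[OF assms] by blast
  obtain C1 where C1: "C1 > 0" "\<And>\<phi>. L2_circle \<phi> \<Longrightarrow> garsia_norm_w w \<phi> \<le> ennreal C1 * garsia_norm \<phi>"
    using garsia_norm_w_compare[OF w A2_line_one] unfolding garsia_norm_eq by blast
  obtain C2 where C2: "C2 > 0" "\<And>\<phi>. L2_circle \<phi> \<Longrightarrow> garsia_norm \<phi> \<le> ennreal C2 * garsia_norm_w w \<phi>"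
    using garsia_norm_w_compare[OF A2_line_one w] unfolding garsia_norm_eq by blast
  have max: "ennreal C1 * x \<le> ennreal (max C1 C2) * x" "ennreal C2 * x \<le> ennreal (max C1 C2) * x" for x
    by (auto intro!: mult_right_mono ennreal_leI)
  show ?thesis
    using C1 C2 by (intro exI[of _ "max C1 C2"]) (auto intro: order_trans[OF C1(2) max(1)] order_trans[OF C2(2) max(2)])
qed

end
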